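(* Let $F\colon X\to Y\cup\{+\infty_Y\}$ be proper and $K$-convex, $G\colon X\to Z\cup\{+\infty_Z\}$ proper and $S$-convex, $C\subset X$ nonempty and convex, $A:=C\cap G^{-1}(-S)$, and assume $A\cap\operatorname{dom}F\neq\emptyset$. Consider the conditions $(C_1)$ there is $x_1\in C\cap\operatorname{dom}F$ with $G(x_1)\in-\operatorname{int}S$; $(C_2)$ there is $x_2\in C\cap\operatorname{dom}G$ such that $F$ is continuous at $x_2$; $(C_3)$ there is $x_3\in C$ such that $G$ is continuous at $x_3$. Let $\mathcal{A}_1,\mathcal{A}_2,\mathcal{A}_3\subset\mathcal{L}(X,Y)\times Y$ be the sets attached to $(F;G,C)$ defined in the context. Then: (a) If $(C_1)$ holds then $\operatorname{epi}(F+I_A)^*=\mathcal{A}_1$. (b) If $(C_1)$ and $(C_2)$ hold then $\operatorname{epi}(F+I_A)^*=\mathcal{A}_2$. (c) If $(C_1)$, $(C_2)$ and $(C_3)$ hold then $\operatorname{epi}(F+I_A)^*=\mathcal{A}_3$.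
   Context: **Spaces and order.** $X,Y,Z$ are locally convex Hausdorff topological vector spaces; $K\subset Y$ is a proper ($K\ne Y$) closed convex cone with $\operatorname{int}K\neq\emptyset$; $S\subset Z$ is a nonempty closed convex cone. In $Y$: $y_1<_K y_2$ iff $y_1-y_2\in-\operatorname{int}K$, and $y_1\leqq_K y_2$ iff $y_1-y_2\in-K$. $Y^\bullet:=Y\cup\{-\infty_Y,+\infty_Y\}$ with $-\infty_Y<_K y<_K+\infty_Y$ for all $y\in Y$ (and $-\infty_Y<_K+\infty_Y$). Conventions: $-(\pm\infty_Y)=\mp\infty_Y$; $(+\infty_Y)+y=+\infty_Y$ for $y\in Y\cup\{+\infty_Y\}$; $(-\infty_Y)+y=-\infty_Y$ for $y\in Y\cup\{-\infty_Y\}$; sums of sets are elementwise. **Weak supremum.** For $M\subset Y^\bullet$, $\operatorname{WSup}M$ is the set of $\bar v\in Y^\bullet$ such that $\bar v\not<_K v$ for all $v\in M$ and, for every $\tilde v\in Y^\bullet$ with $\tilde v<_K\bar v$, there is $v\in M$ with $\tilde v<_K v$. **Set order and WS-sum.** For nonempty $M,N\subset Y^\bullet$, $M\preccurlyeq_K N$ means $v\not<_K u$ for all $u\in M$, $v\in N$. $\mathcal{P}_p(Y)$ is the collection of all $U\subset Y$ such that $Y=(U-\operatorname{int}K)\cup U\cup(U+\operatorname{int}K)$ with the three sets pairwise disjoint. For $U,V\in\mathcal{P}_p(Y)\cup\{\{+\infty_Y\}\}$, $U\uplus V:=\operatorname{WSup}(U+V)$, which again lies in $\mathcal{P}_p(Y)\cup\{\{+\infty_Y\}\}$.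 **Mappings.** For $H\colon X\to Y\cup\{+\infty_Y\}$, $\operatorname{dom}H=\{x: H(x)\neq+\infty_Y\}$; $H$ is proper if $\operatorname{dom}H\ne\emptyset$; $H$ is $K$-convex if $\{(x,y)\in X\times Y: H(x)\leqq_K y\}$ is convex. The same definitions are used for $G$ with $Z,S$ in place of $Y,K$. A mapping is continuous at $x$ if its value at $x$ is finite (in $Y$, resp. $Z$) and every neighbourhood of this value contains the image of some neighbourhood of $x$. $I_D(x)=0_Y$ if $x\in D$, $+\infty_Y$ otherwise. $\mathcal{L}(X,Y)$ is the space of continuous linear mappings $X\to Y$, and $\mathcal{L}_+(S,K):=\{T\in\mathcal{L}(Z,Y): T(S)\subset K\}$. $(T\circ G)(x):=+\infty_Y$ when $G(x)=+\infty_Z$. **Conjugates and epigraphs.** $H^*(L):=\operatorname{WSup}\{L(x)-H(x): x\in X\}$ for $L\in\mathcal{L}(X,Y)$; $\operatorname{dom}H^*:=\{L: H^*(L)\ne\{+\infty_Y\}\}$; $\operatorname{epi}H^*:=\{(L,y)\in\mathcal{L}(X,Y)\times Y: y\in H^*(L)+K\}$. The extended epigraph is $\mathfrak{E}\mathrm{pi}\,H^*:=\{(L,U)\in\mathcal{L}(X,Y)\times\mathcal{P}_p(Y): L\in\operatorname{dom}H^*,\ H^*(L)\preccurlyeq_K U\}$. For $\mathscr{M}_1,\mathscr{M}_2\subset\mathcal{L}(X,Y)\times\mathcal{P}_p(Y)$, $\mathscr{M}_1\boxplus\mathscr{M}_2:=\{(L_1+L_2,U_1\uplus U_2):(L_i,U_i)\in\mathscr{M}_i,\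 U_1\uplus U_2\in\mathcal{P}_p(Y)\}$ (pairs with $U_1\uplus U_2=\{+\infty_Y\}$ are discarded); this operation is commutative and associative. For $\mathscr{M}\subset\mathcal{L}(X,Y)\times\mathcal{P}_p(Y)$, $\Psi(\mathscr{M}):=\bigcup_{(L,U)\in\mathscr{M}}\{L\}\times U\subset\mathcal{L}(X,Y)\times Y$. **The sets $\mathcal{A}_i$.** $$\mathcal{A}_1:=\Psi\Big(\bigcup_{T\in\mathcal{L}_+(S,K)}\mathfrak{E}\mathrm{pi}(F+I_C+T\circ G)^*\Big),$$ $$\mathcal{A}_2:=\Psi\Big(\mathfrak{E}\mathrm{pi}F^*\boxplus\bigcup_{T\in\mathcal{L}_+(S,K)}\mathfrak{E}\mathrm{pi}(I_C+T\circ G)^*\Big),$$ $$\mathcal{A}_3:=\Psi\Big(\mathfrak{E}\mathrm{pi}F^*\boxplus\mathfrak{E}\mathrm{pi}I_C^*\boxplus\bigcup_{T\in\mathcal{L}_+(S,K)}\mathfrak{E}\mathrm{pi}(T\circ G)^*\Big).$$ *)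

theory Defs
  imports "HOL-Analysis.Analysis" "HOL-Library.Extended"
begin

section \<open>Locally convex Hausdorff spaces\<close>

text \<open>The last axiom spells out \<^const>\<open>convex\<close>, which is not available inside the class context.\<close>

class locally_convex_space = real_vector + topological_ab_group_add + t2_space +
  assumes tendsto_scaleR_Pair:
    "filterlim (\<lambda>p. fst p *\<^sub>R snd p) (nhds (c *\<^sub>R x)) (nhds c \<times>\<^sub>F nhds x)"
  assumes convex_nhds_zero:
    "open U \<Longrightarrow> 0 \<in> U \<Longrightarrow> \<exists>V. open V \<and>
       (\<forall>a\<in>V. \<forall>b\<in>V. \<forall>u\<ge>0. \<forall>v\<ge>0. u + v = 1 \<longrightarrow> u *\<^sub>R a + v *\<^sub>R b \<in> V) \<and> 0 \<in> V \<and> V \<subseteq> U"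

lemma locally_convex_space_convex_nhds:
  fixes U :: "'a::locally_convex_space set"
  shows "open U \<Longrightarrow> 0 \<in> U \<Longrightarrow> \<exists>V. open V \<and> convex V \<and> 0 \<in> V \<and> V \<subseteq> U"
  unfolding convex_def by (rule convex_nhds_zero)

instance real_normed_vector < locally_convex_space
proof
  fix c :: real and x :: 'a
  show "filterlim (\<lambda>p. fst p *\<^sub>R snd p) (nhds (c *\<^sub>R x)) (nhds c \<times>\<^sub>F nhds x)"
    unfolding nhds_prod[symmetric]
    by (intro tendsto_scaleR tendsto_fst[OF filterlim_ident, of "(c, x)", simplified]
          tendsto_snd[OF filterlim_ident, of "(c, x)", simplified])
next
  fix U :: "'a set"
  assume "open U" "0 \<in> U"
  then obtain e where "e > 0" "ball 0 e \<subseteq> U"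
    using openE by blast
  then show "\<exists>V. open V \<and>
      (\<forall>a\<in>V. \<forall>b\<in>V. \<forall>u\<ge>0. \<forall>v\<ge>0. u + v = 1 \<longrightarrow> u *\<^sub>R a + v *\<^sub>R b \<in> V) \<and> 0 \<in> V \<and> V \<subseteq> U"
    unfolding convex_def[symmetric]
    by (intro exI[of _ "ball 0 e"]) auto
qed

definition cont_lin :: "('x::locally_convex_space \<Rightarrow> 'y::locally_convex_space) set" where
  "cont_lin = {L. linear L \<and> continuous_on UNIV L}"

definition pos_cont_lin ::
  "'z::locally_convex_space set \<Rightarrow> 'y::locally_convex_space set \<Rightarrow> ('z \<Rightarrow> 'y) set" where
  "pos_cont_lin S K = {T \<in> cont_lin. T ` S \<subseteq> K}"


section \<open>The extended space and weak suprema\<close>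

text \<open>
  The space \<open>Y\<close> with a least and a greatest element adjoined is \<^typ>\<open>'y extended\<close>; its negation
  and addition obey the usual conventions. The library totalises addition by
  \<open>Minf + Pinf = Pinf\<close>. This value is never used below: the mappings considered do not take the
  value \<^const>\<open>Minf\<close>, and \<open>WS\<close>-sums are only formed of sets not containing \<^const>\<open>Minf\<close>.
  The library order on \<^typ>\<open>'y extended\<close> plays no role; the order is the one given by the cone.

  On sets, unary and binary minus denote complement and set difference, so the algebraic negative
  of a set \<open>A\<close> is written \<open>uminus ` A\<close>; \<open>A + B\<close> is the elementwise sum.
\<close>

definition cone_le :: "'y::locally_convex_space set \<Rightarrow> 'y \<Rightarrow> 'y \<Rightarrow> bool" where
  "cone_le K y1 y2 \<longleftrightarrow> y1 - y2 \<in> uminus ` K"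

fun cone_less :: "'y::locally_convex_space set \<Rightarrow> 'y extended \<Rightarrow> 'y extended \<Rightarrow> bool" where
  "cone_less K (Fin y1) (Fin y2) \<longleftrightarrow> y1 - y2 \<in> uminus ` interior K"
| "cone_less K Minf (Fin y) \<longleftrightarrow> True"
| "cone_less K (Fin y) Pinf \<longleftrightarrow> True"
| "cone_less K Minf Pinf \<longleftrightarrow> True"
| "cone_less K _ _ \<longleftrightarrow> False"

definition WSup :: "'y::locally_convex_space set \<Rightarrow> 'y extended set \<Rightarrow> 'y extended set" where
  "WSup K M = {v. (\<forall>u\<in>M. \<not> cone_less K v u) \<and>
                  (\<forall>w. cone_less K w v \<longrightarrow> (\<exists>u\<in>M. cone_less K w u))}"

text \<open>Only meaningful for nonempty \<open>M\<close> and \<open>N\<close>.\<close>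

definition set_prec ::
  "'y::locally_convex_space set \<Rightarrow> 'y extended set \<Rightarrow> 'y extended set \<Rightarrow> bool" where
  "set_prec K M N \<longleftrightarrow> (\<forall>u\<in>M. \<forall>v\<in>N. \<not> cone_less K v u)"

text \<open>Members of \<open>Pp K\<close> are subsets of \<open>Y\<close>, regarded as subsets of the extended space.\<close>

definition Pp :: "'y::locally_convex_space set \<Rightarrow> 'y extended set set" where
  "Pp K = {Fin ` U | U.
     UNIV = (U + uminus ` interior K) \<union> U \<union> (U + interior K) \<and>
     (U + uminus ` interior K) \<inter> U = {} \<and>
     U \<inter> (U + interior K) = {} \<and>
     (U + uminus ` interior K) \<inter> (U + interior K) = {}}"

definition ws_sum ::
  "'y::locally_convex_space set \<Rightarrow> 'y extended set \<Rightarrow> 'y extended set \<Rightarrow> 'y extended set" where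
  "ws_sum K U V = WSup K (U + V)"


section \<open>Extended vector-valued mappings\<close>

text \<open>
  A mapping into \<open>Y\<close> with only the greatest element adjoined is a function \<open>H\<close> into the extended
  space with \<open>never_Minf H\<close>.
\<close>

definition never_Minf :: "('x \<Rightarrow> 'y extended) \<Rightarrow> bool" where
  "never_Minf H \<longleftrightarrow> (\<forall>x. H x \<noteq> Minf)"

definition edom :: "('x \<Rightarrow> 'y extended) \<Rightarrow> 'x set" where
  "edom H = {x. H x \<noteq> Pinf}"

definition proper_ext :: "('x \<Rightarrow> 'y extended) \<Rightarrow> bool" where
  "proper_ext H \<longleftrightarrow> edom H \<noteq> {}"

definition cone_convex ::
  "'y::locally_convex_space set \<Rightarrow> ('x::real_vector \<Rightarrow> 'y extended) \<Rightarrow> bool" where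
  "cone_convex K H \<longleftrightarrow> convex {(x, y). \<exists>h. H x = Fin h \<and> cone_le K h y}"

definition ext_continuous_at ::
  "('x::topological_space \<Rightarrow> 'y::topological_space extended) \<Rightarrow> 'x \<Rightarrow> bool" where
  "ext_continuous_at H x \<longleftrightarrow>
     (\<exists>h. H x = Fin h \<and>
       (\<forall>V. open V \<and> h \<in> V \<longrightarrow> (\<exists>U. open U \<and> x \<in> U \<and> H ` U \<subseteq> Fin ` V)))"

definition ind_map :: "'x set \<Rightarrow> 'x \<Rightarrow> 'y::zero extended" where
  "ind_map D x = (if x \<in> D then Fin 0 else Pinf)"

definition comp_map :: "('z \<Rightarrow> 'y) \<Rightarrow> ('x \<Rightarrow> 'z extended) \<Rightarrow> 'x \<Rightarrow> 'y extended" where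
  "comp_map T G = map_extended T \<circ> G"

definition add_map ::
  "('x \<Rightarrow> 'y::plus extended) \<Rightarrow> ('x \<Rightarrow> 'y extended) \<Rightarrow> 'x \<Rightarrow> 'y extended" (infixl \<open>+\<^sub>m\<close> 65) where
  "(H1 +\<^sub>m H2) x = H1 x + H2 x"


section \<open>Conjugates and epigraphs\<close>

definition conj_map ::
  "'y::locally_convex_space set \<Rightarrow> ('x::locally_convex_space \<Rightarrow> 'y extended) \<Rightarrow>
   ('x \<Rightarrow> 'y) \<Rightarrow> 'y extended set" where
  "conj_map K H L = WSup K {Fin (L x) - H x | x. True}"

definition dom_conj ::
  "'y::locally_convex_space set \<Rightarrow> ('x::locally_convex_space \<Rightarrow> 'y extended) \<Rightarrow> ('x \<Rightarrow> 'y) set" where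
  "dom_conj K H = {L \<in> cont_lin. conj_map K H L \<noteq> {Pinf}}"

definition epi_conj ::
  "'y::locally_convex_space set \<Rightarrow> ('x::locally_convex_space \<Rightarrow> 'y extended) \<Rightarrow>
   (('x \<Rightarrow> 'y) \<times> 'y) set" where
  "epi_conj K H = {(L, y). L \<in> cont_lin \<and> Fin y \<in> conj_map K H L + Fin ` K}"

definition ext_epi_conj ::
  "'y::locally_convex_space set \<Rightarrow> ('x::locally_convex_space \<Rightarrow> 'y extended) \<Rightarrow>
   (('x \<Rightarrow> 'y) \<times> 'y extended set) set" where
  "ext_epi_conj K H =
     {(L, U). L \<in> cont_lin \<and> U \<in> Pp K \<and> L \<in> dom_conj K H \<and> set_prec K (conj_map K H L) U}"

definition box_sum ::
  "'y::locally_convex_space set \<Rightarrow> (('x \<Rightarrow> 'y) \<times> 'y extended set) set \<Rightarrow>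
   (('x \<Rightarrow> 'y) \<times> 'y extended set) set \<Rightarrow> (('x \<Rightarrow> 'y) \<times> 'y extended set) set" where
  "box_sum K M1 M2 =
     {((\<lambda>x. L1 x + L2 x), ws_sum K U1 U2) | L1 U1 L2 U2.
        (L1, U1) \<in> M1 \<and> (L2, U2) \<in> M2 \<and> ws_sum K U1 U2 \<in> Pp K}"

definition Psi :: "(('x \<Rightarrow> 'y) \<times> 'y extended set) set \<Rightarrow> (('x \<Rightarrow> 'y) \<times> 'y) set" where
  "Psi M = (\<Union>(L, U)\<in>M. {L} \<times> {y. Fin y \<in> U})"


section \<open>The constrained problem\<close>

definition feasible_set ::
  "'z::locally_convex_space set \<Rightarrow> ('x \<Rightarrow> 'z extended) \<Rightarrow> 'x set \<Rightarrow> 'x set" where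
  "feasible_set S G C = C \<inter> G -` (Fin ` uminus ` S)"

definition A1 ::
  "'y::locally_convex_space set \<Rightarrow> 'z::locally_convex_space set \<Rightarrow>
   ('x::locally_convex_space \<Rightarrow> 'y extended) \<Rightarrow> ('x \<Rightarrow> 'z extended) \<Rightarrow> 'x set \<Rightarrow>
   (('x \<Rightarrow> 'y) \<times> 'y) set" where
  "A1 K S F G C =
     Psi (\<Union>T\<in>pos_cont_lin S K. ext_epi_conj K (F +\<^sub>m ind_map C +\<^sub>m comp_map T G))"

definition A2 ::
  "'y::locally_convex_space set \<Rightarrow> 'z::locally_convex_space set \<Rightarrow>
   ('x::locally_convex_space \<Rightarrow> 'y extended) \<Rightarrow> ('x \<Rightarrow> 'z extended) \<Rightarrow> 'x set \<Rightarrow>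
   (('x \<Rightarrow> 'y) \<times> 'y) set" where
  "A2 K S F G C =
     Psi (box_sum K (ext_epi_conj K F)
       (\<Union>T\<in>pos_cont_lin S K. ext_epi_conj K (ind_map C +\<^sub>m comp_map T G)))"

definition A3 ::
  "'y::locally_convex_space set \<Rightarrow> 'z::locally_convex_space set \<Rightarrow>
   ('x::locally_convex_space \<Rightarrow> 'y extended) \<Rightarrow> ('x \<Rightarrow> 'z extended) \<Rightarrow> 'x set \<Rightarrow>
   (('x \<Rightarrow> 'y) \<times> 'y) set" where
  "A3 K S F G C =
     Psi (box_sum K (box_sum K (ext_epi_conj K F) (ext_epi_conj K (ind_map C)))
       (\<Union>T\<in>pos_cont_lin S K. ext_epi_conj K (comp_map T G)))"

definition cond_C1 ::
  "'z::locally_convex_space set \<Rightarrow> ('x \<Rightarrow> 'y extended) \<Rightarrow> ('x \<Rightarrow> 'z extended) \<Rightarrow> 'x set \<Rightarrow> bool" where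
  "cond_C1 S F G C \<longleftrightarrow> (\<exists>x1 \<in> C \<inter> edom F. G x1 \<in> Fin ` uminus ` interior S)"

definition cond_C2 ::
  "('x::topological_space \<Rightarrow> 'y::topological_space extended) \<Rightarrow> ('x \<Rightarrow> 'z extended) \<Rightarrow> 'x set \<Rightarrow> bool" where
  "cond_C2 F G C \<longleftrightarrow> (\<exists>x2 \<in> C \<inter> edom G. ext_continuous_at F x2)"

definition cond_C3 ::
  "('x::topological_space \<Rightarrow> 'z::topological_space extended) \<Rightarrow> 'x set \<Rightarrow> bool" where
  "cond_C3 G C \<longleftrightarrow> (\<exists>x3 \<in> C. ext_continuous_at G x3)"

end

theory Submission
  imports Defs
begin

text \<open>
  The argument reduces everything to scalar convex duality.

  For a mapping \<open>H\<close> that is not identically \<^const>\<open>Pinf\<close> and a continuous linear \<open>L\<close>, the pair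
  \<open>(L, y)\<close> lies in the epigraph of the conjugate of \<open>H\<close> iff \<open>y\<close> is not strictly below any value
  \<open>L x - H x\<close> (\<open>epi_conj_iff_majorizes\<close>), and a pair \<open>(L, U)\<close> in its extended
  epigraph satisfies the same condition with every point of \<open>U\<close> in place of \<open>y\<close>
  (\<open>ext_epi_conj_majorizes\<close>). This condition passes to \<open>WS\<close>-sums (\<open>ws_sum_majorizes\<close>) and, by
  positivity of \<open>T\<close>, from the Lagrangian to the constrained mapping
  (\<open>Lagrangian_majorizes_imp_constrained\<close>). Hence all three sets are contained in the epigraph.

  For the converse inclusions let \<open>(L, y)\<close> be in the epigraph. Under the Slater condition, separating
  the origin from a convex set in \<open>Y \<times> Z\<close> gives a functional \<open>\<phi>\<close>, positive on the interior of \<open>K\<close>,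
  and a functional \<open>\<psi>\<close>, nonnegative on \<open>S\<close>, such that
  \<open>\<phi> (L x - F x) - \<psi> (G x) \<le> \<phi> y\<close> for \<open>x \<in> C\<close> with finite values (\<open>scalar_multipliers\<close>). Choose \<open>k\<close> in
  the interior of \<open>K\<close> with \<open>\<phi> k = 1\<close>. Then \<open>T z = \<psi> z *\<^sub>R k\<close> is an admissible operator, and the
  hyperplane where \<open>\<phi>\<close> has the value \<open>\<phi> y\<close> is an admissible set containing \<open>y\<close>. This settles the first
  set.

  For the other two, the scalar inequality is split among its terms. If one of the convex functions
  involved is continuous at a suitable point, an affine function fits between it and the others
  (\<open>convex_sandwich\<close>), and its linear part \<open>a\<close> yields the summand \<open>\<lambda>x. a x *\<^sub>R k\<close> of \<open>L\<close>. Each summand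
  comes with a hyperplane of \<open>\<phi>\<close>, and the \<open>WS\<close>-sum of hyperplanes of the same functional simply
  adds their levels (\<open>ws_sum_hyperplane\<close>).

  Both separations rest on one algebraic Hahn-Banach lemma, \<open>separation_at_core_point\<close>; continuity of
  the functionals follows afterwards from one-sided bounds.
\<close>

section \<open>Separation of a point from a convex set with a core point\<close>

text \<open>
  The algebraic Hahn-Banach theorem, for a set with a core point \<open>e\<close> instead of an interior point.
  The convex cone spanned by \<open>A\<close> omits \<open>- e\<close>, for otherwise \<open>0\<close> would be a convex combination of
  \<open>e\<close> and a point of \<open>A\<close>. Zorn's lemma enlarges it to a cone \<open>Q\<close> that is maximal with this property.
  Maximality forces \<open>x \<in> Q\<close> or \<open>- x \<in> Q\<close> for every \<open>x\<close>, so \<open>Q\<close> induces a total preorder in which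
  \<open>e\<close> is an order unit. The position of \<open>x\<close> among the multiples of \<open>e\<close> is then a single real number
  \<open>f x\<close>, and \<open>f\<close> is the functional sought. Working without a topology makes it applicable to
  product spaces and leaves continuity to be derived from one-sided bounds.
\<close>

lemma separation_at_core_point:
  fixes A :: "'a::real_vector set"
  assumes "convex A" "0 \<notin> A" "e \<in> A" and core: "\<And>x. \<exists>t>0. e + t *\<^sub>R x \<in> A"
  obtains f :: "'a \<Rightarrow> real" where "linear f" "f e = 1" "\<And>x. x \<in> A \<Longrightarrow> 0 \<le> f x"
proof -
  define P where "P = convex_cone hull A"
  have P_subset: "y = 0 \<or> (\<exists>x\<in>A. \<exists>c>0. y = c *\<^sub>R x)" if "y \<in> P" for y
  proof -
    consider "y = 0" | x c where "x \<in> A" "0 \<le> c" "y = c *\<^sub>R x"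
      using \<open>y \<in> P\<close> unfolding P_def convex_cone_hull_convex_hull hull_same[of convex A, OF assms(1)] by blast
    then show ?thesis
    proof cases
      case 2
      then show ?thesis by (cases "c = 0") (simp, metis less_eq_real_def)
    qed simp
  qed
  have eP: "- e \<notin> P"
  proof
    assume "- e \<in> P"
    then consider "- e = 0" | c x where "- e = c *\<^sub>R x" "c > 0" "x \<in> A"
      using P_subset by blast
    then show False
    proof cases
      case 1
      then show ?thesis using assms by simp
    next
      case 2
      have "(1 / (1 + c)) *\<^sub>R e + (c / (1 + c)) *\<^sub>R x \<in> A"
        using 2 assms by (intro convexD[OF assms(1)]) (auto simp: field_simps)
      moreover have "(1 / (1 + c)) *\<^sub>R e + (c / (1 + c)) *\<^sub>R x = (1 / (1 + c)) *\<^sub>R (e + c *\<^sub>R x)"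
        by (simp add: algebra_simps)
      moreover have "e + c *\<^sub>R x = 0"
        using 2(1) by (metis add.right_inverse)
      ultimately show False using assms(2) by simp
    qed
  qed
  define \<Q> where "\<Q> = {Q. convex_cone Q \<and> P \<subseteq> Q \<and> - e \<notin> Q}"
  have "\<exists>Q\<in>\<Q>. \<forall>R\<in>\<Q>. Q \<subseteq> R \<longrightarrow> R = Q"
  proof (rule subset_Zorn_nonempty)
    show "\<Q> \<noteq> {}"
      using eP convex_cone_convex_cone_hull[of A] by (auto simp: \<Q>_def P_def)
  next
    fix \<C> assume ne: "\<C> \<noteq> {}" and ch: "subset.chain \<Q> \<C>"
    have sub: "\<C> \<subseteq> \<Q>" and tot: "\<And>U V. U \<in> \<C> \<Longrightarrow> V \<in> \<C> \<Longrightarrow> U \<subseteq> V \<or> V \<subseteq> U"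
      using ch by (auto simp: subset.chain_def)
    have "convex_cone (\<Union>\<C>)"
      unfolding convex_cone_iff
    proof (intro conjI ballI allI impI)
      show "0 \<in> \<Union>\<C>"
        using ne sub convex_cone_contains_0 unfolding \<Q>_def by blast
    next
      fix x y assume "x \<in> \<Union>\<C>" "y \<in> \<Union>\<C>"
      then obtain U V where "U \<in> \<C>" "V \<in> \<C>" "x \<in> U" "y \<in> V" by auto
      then obtain W where "W \<in> \<C>" "x \<in> W" "y \<in> W" using tot by blast
      then show "x + y \<in> \<Union>\<C>"
        using sub convex_cone_add[of W x y] unfolding \<Q>_def by blast
    next
      fix x and c :: real assume "x \<in> \<Union>\<C>" "0 \<le> c"
      then obtain W where "W \<in> \<C>" "x \<in> W" by blast
      then show "c *\<^sub>R x \<in> \<Union>\<C>"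
        using sub \<open>0 \<le> c\<close> convex_cone_scaleR[of W c x] unfolding \<Q>_def by blast
    qed
    then show "\<Union>\<C> \<in> \<Q>"
      using ne sub unfolding \<Q>_def by blast
  qed
  then obtain Q where Q: "convex_cone Q" "P \<subseteq> Q" "- e \<notin> Q"
    and Qmax: "\<And>R. convex_cone R \<Longrightarrow> - e \<notin> R \<Longrightarrow> Q \<subseteq> R \<Longrightarrow> R = Q"
    by (auto simp: \<Q>_def)
  have AQ: "A \<subseteq> Q"
    using Q(2) hull_subset[of A convex_cone] by (auto simp: P_def)
  have add: "x + y \<in> Q" if "x \<in> Q" "y \<in> Q" for x y
    using that Q(1) by (simp add: convex_cone_add)
  have scale: "c *\<^sub>R x \<in> Q" if "x \<in> Q" "c \<ge> 0" for x c
    using that Q(1) by (simp add: convex_cone_scaleR)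
  \<comment> \<open>If \<open>x \<notin> Q\<close>, adjoining the ray of \<open>x\<close> to \<open>Q\<close> must make \<open>- e\<close> reachable.\<close>
  have reach: "\<exists>q t. q \<in> Q \<and> t > 0 \<and> - e = q + t *\<^sub>R x" if "x \<notin> Q" for x
  proof (rule ccontr)
    assume none: "\<not> ?thesis"
    define R where "R = {q + t *\<^sub>R x | q t. q \<in> Q \<and> t \<ge> 0}"
    have "convex_cone R"
      unfolding convex_cone_iff
    proof (intro conjI ballI allI impI)
      show "0 \<in> R"
        using convex_cone_contains_0[OF Q(1)] by (force simp: R_def intro: exI[of _ "0::real"])
    next
      fix a b assume "a \<in> R" "b \<in> R"
      then obtain p s q t where "a = p + s *\<^sub>R x" "b = q + t *\<^sub>R x" "p \<in> Q" "q \<in> Q" "s \<ge> 0" "t \<ge> 0"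
        by (auto simp: R_def)
      then have "a + b = (p + q) + (s + t) *\<^sub>R x" "p + q \<in> Q" "s + t \<ge> 0"
        using add by (auto simp: algebra_simps)
      then show "a + b \<in> R" unfolding R_def by blast
    next
      fix a and c :: real assume "a \<in> R" "0 \<le> c"
      then obtain p s where "a = p + s *\<^sub>R x" "p \<in> Q" "s \<ge> 0"
        by (auto simp: R_def)
      then have "c *\<^sub>R a = c *\<^sub>R p + (c * s) *\<^sub>R x" "c *\<^sub>R p \<in> Q" "c * s \<ge> 0"
        using scale \<open>0 \<le> c\<close> by (auto simp: algebra_simps)
      then show "c *\<^sub>R a \<in> R" unfolding R_def by blast
    qed
    moreover have "- e \<notin> R"
      using none Q(3) by (auto simp: R_def) (metis add_0_right less_eq_real_def scaleR_zero_left)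
    moreover have "Q \<subseteq> R"
      unfolding R_def by (force intro: exI[of _ "0::real"])
    ultimately have "R = Q" by (rule Qmax)
    moreover have "0 \<in> Q" using scale[of e 0] AQ assms(3) by auto
    then have "x \<in> R" unfolding R_def by (force intro: exI[of _ "1::real"])
    ultimately show False using that by simp
  qed
  have total: "x \<in> Q \<or> - x \<in> Q" for x
  proof (rule ccontr)
    assume "\<not> ?thesis"
    then obtain q t p s where *: "q \<in> Q" "t > 0" "- e = q + t *\<^sub>R x" "p \<in> Q" "s > 0" "- e = p + s *\<^sub>R (- x)"
      using reach[of x] reach[of "- x"] by blast
    have "(s + t) *\<^sub>R (- e) = s *\<^sub>R (- e) + t *\<^sub>R (- e)"
      by (simp only: scaleR_left_distrib)
    also have "\<dots> = s *\<^sub>R (q + t *\<^sub>R x) + t *\<^sub>R (p + s *\<^sub>R (- x))"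
      by (simp only: *(3)[symmetric] *(6)[symmetric])
    also have "\<dots> = s *\<^sub>R q + t *\<^sub>R p"
      by (simp add: algebra_simps)
    finally have "(s + t) *\<^sub>R (- e) = s *\<^sub>R q + t *\<^sub>R p" .
    then have "(1 / (s + t)) *\<^sub>R ((s + t) *\<^sub>R (- e)) \<in> Q"
      using * by (simp only:) (intro scale add, auto)
    then show False using * Q(3) by simp
  qed
  \<comment> \<open>From here on \<open>e\<close> is an order unit of the total preorder given by \<open>Q\<close>.\<close>
  have unit: "\<exists>t. t *\<^sub>R e - x \<in> Q" for x
  proof -
    obtain t where "t > 0" "e + t *\<^sub>R (- x) \<in> A" using core by blast
    then have "(1 / t) *\<^sub>R (e + t *\<^sub>R (- x)) \<in> Q" using AQ by (intro scale) auto
    moreover have "(1 / t) *\<^sub>R (e + t *\<^sub>R (- x)) = (1 / t) *\<^sub>R e - x"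
      using \<open>t > 0\<close> by (simp add: algebra_simps)
    ultimately show ?thesis by metis
  qed
  have order: "s \<le> t" if "x - s *\<^sub>R e \<in> Q" "t *\<^sub>R e - x \<in> Q" for s t x
  proof (rule ccontr)
    assume "\<not> s \<le> t"
    have "(1 / (s - t)) *\<^sub>R ((x - s *\<^sub>R e) + (t *\<^sub>R e - x)) \<in> Q"
      using that \<open>\<not> s \<le> t\<close> by (intro scale add) auto
    moreover have "(x - s *\<^sub>R e) + (t *\<^sub>R e - x) = (s - t) *\<^sub>R (- e)"
      by (simp add: algebra_simps)
    ultimately show False using Q(3) \<open>\<not> s \<le> t\<close> by simp
  qed
  define f where "f x = Inf {t. t *\<^sub>R e - x \<in> Q}" for x
  have bdd: "bdd_below {t. t *\<^sub>R e - x \<in> Q}" for x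
  proof -
    obtain t where "t *\<^sub>R e - (- x) \<in> Q" using unit by blast
    then have "x - (- t) *\<^sub>R e \<in> Q" by (simp add: algebra_simps)
    then show ?thesis using order by (intro bdd_belowI[of _ "- t"]) auto
  qed
  have ge: "s \<le> f x" if "x - s *\<^sub>R e \<in> Q" for s x
    unfolding f_def using unit order that by (intro cInf_greatest) auto
  have le: "f x \<le> t" if "t *\<^sub>R e - x \<in> Q" for t x
    unfolding f_def using that bdd by (intro cInf_lower) auto
  have below: "x - s *\<^sub>R e \<in> Q" if "s < f x" for s x
    using le[of s x] total[of "x - s *\<^sub>R e"] that by auto
  have above: "t *\<^sub>R e - x \<in> Q" if "f x < t" for t x
    using ge[of x t] total[of "x - t *\<^sub>R e"] that by auto
  have fadd: "f (x + y) = f x + f y" for x y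
  proof (rule antisym)
    show "f (x + y) \<le> f x + f y"
    proof (rule field_le_epsilon)
      fix d :: real assume "d > 0"
      then have "(f x + d / 2) *\<^sub>R e - x + ((f y + d / 2) *\<^sub>R e - y) \<in> Q"
        by (intro add above) auto
      also have "(f x + d / 2) *\<^sub>R e - x + ((f y + d / 2) *\<^sub>R e - y)
        = ((f x + d / 2) + (f y + d / 2)) *\<^sub>R e - (x + y)" unfolding scaleR_left_distrib by simp
      finally have "f (x + y) \<le> (f x + d / 2) + (f y + d / 2)" by (rule le)
      then show "f (x + y) \<le> f x + f y + d" by simp
    qed
    show "f x + f y \<le> f (x + y)"
    proof (rule field_le_epsilon)
      fix d :: real assume "d > 0"
      then have "x - (f x - d / 2) *\<^sub>R e + (y - (f y - d / 2) *\<^sub>R e) \<in> Q"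
        by (intro add below) auto
      also have "x - (f x - d / 2) *\<^sub>R e + (y - (f y - d / 2) *\<^sub>R e)
        = (x + y) - ((f x - d / 2) + (f y - d / 2)) *\<^sub>R e" unfolding scaleR_left_distrib by simp
      finally have "(f x - d / 2) + (f y - d / 2) \<le> f (x + y)" by (rule ge)
      then show "f x + f y \<le> f (x + y) + d" by simp
    qed
  qed
  have fpos: "0 \<le> f x" if "x \<in> Q" for x
    using ge[of x 0] that by simp
  have f0: "f 0 = 0" using fadd[of 0 0] by simp
  have fminus: "f (- x) = - f x" for x
    using fadd[of x "- x"] f0 by simp
  have fscale_pos: "f (c *\<^sub>R x) = c * f x" if "c > 0" for c x
  proof (rule antisym)
    have upper: "f (c *\<^sub>R x) \<le> c * t" if "f x < t" for t
      using scale[OF above[OF that], of c] \<open>c > 0\<close> by (intro le) (simp add: algebra_simps)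
    have "f (c *\<^sub>R x) / c \<le> f x"
      by (rule dense_ge) (use upper \<open>c > 0\<close> in \<open>auto simp: field_simps\<close>)
    then show "f (c *\<^sub>R x) \<le> c * f x" using \<open>c > 0\<close> by (simp add: field_simps)
    have lower: "c * s \<le> f (c *\<^sub>R x)" if "s < f x" for s
      using scale[OF below[OF that], of c] \<open>c > 0\<close> by (intro ge) (simp add: algebra_simps)
    have "f x \<le> f (c *\<^sub>R x) / c"
      by (rule dense_le) (use lower \<open>c > 0\<close> in \<open>auto simp: field_simps\<close>)
    then show "c * f x \<le> f (c *\<^sub>R x)" using \<open>c > 0\<close> by (simp add: field_simps)
  qed
  have fscale: "f (c *\<^sub>R x) = c * f x" for c x
    using fscale_pos[of c x] fscale_pos[of "- c" x] fminus[of "c *\<^sub>R x"] f0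
    by (cases c "0 :: real" rule: linorder_cases) auto
  have "0 \<in> Q" using scale[of e 0] AQ assms(3) by auto
  then have "f e \<le> 1" "1 \<le> f e"
    using ge[of e 1] le[of 1 e] by simp_all
  then have "f e = 1" by simp
  moreover have "linear f"
    using fadd fscale by (intro linearI) auto
  ultimately show ?thesis using that fpos subsetD[OF AQ] by metis
qed

section \<open>Linear functionals and operators on locally convex spaces\<close>

lemma tendsto_scaleR_locally_convex:
  fixes g :: "'b \<Rightarrow> 'a::locally_convex_space"
  assumes "(f \<longlongrightarrow> c) A" "(g \<longlongrightarrow> x) A"
  shows "((\<lambda>t. f t *\<^sub>R g t) \<longlongrightarrow> c *\<^sub>R x) A"
  using filterlim_compose[OF tendsto_scaleR_Pair filterlim_Pair[OF assms]] by simp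

lemma continuous_on_scaleR_locally_convex:
  fixes g :: "'b::topological_space \<Rightarrow> 'a::locally_convex_space"
  assumes "continuous_on A f" "continuous_on A g"
  shows "continuous_on A (\<lambda>t. f t *\<^sub>R g t)"
  using assms tendsto_scaleR_locally_convex unfolding continuous_on_def by blast

lemma open_affine_vimage:
  fixes U :: "'a::locally_convex_space set"
  assumes "open U"
  shows "open {x. a + c *\<^sub>R x \<in> U}"
proof -
  have "continuous_on UNIV (\<lambda>x. a + c *\<^sub>R x)"
    by (intro continuous_on_add continuous_on_scaleR_locally_convex continuous_on_const continuous_on_id)
  then show ?thesis
    using open_vimage[OF assms] by (simp add: vimage_def)
qed

lemma eventually_open_direction:
  fixes U :: "'a::locally_convex_space set"
  assumes "open U" "x \<in> U"
  shows "\<forall>\<^sub>F t in at_right 0. x + t *\<^sub>R v \<in> U"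
proof -
  have "((\<lambda>t. x + t *\<^sub>R v) \<longlongrightarrow> x + 0 *\<^sub>R v) (at_right 0)"
    by (intro tendsto_add tendsto_scaleR_locally_convex tendsto_const tendsto_ident_at)
  then show ?thesis using topological_tendstoD[OF _ assms(1)] assms(2) by simp
qed

lemma eventually_at_right_0_obtains:
  fixes P :: "real \<Rightarrow> bool"
  assumes "\<forall>\<^sub>F t in at_right 0. P t"
  shows "\<exists>t>0. P t"
  using eventually_happens[OF eventually_conj[OF eventually_at_right_less assms]] by auto

lemma open_absorbs_direction:
  fixes U :: "'a::locally_convex_space set"
  assumes "open U" "x \<in> U"
  shows "\<exists>t>0. x + t *\<^sub>R v \<in> U"
  by (intro eventually_at_right_0_obtains eventually_open_direction assms)

text \<open>
  A one-sided bound near one point gives a two-sided bound on a symmetric neighbourhood of \<open>0\<close>, and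
  scaling that neighbourhood gives continuity everywhere. All functionals below come from the
  algebraic separation lemma and become continuous in this way.
\<close>

lemma linear_bounded_above_imp_continuous:
  fixes f :: "'a::locally_convex_space \<Rightarrow> real"
  assumes f: "linear f" and U: "open U" "x0 \<in> U" and bound: "\<And>x. x \<in> U \<Longrightarrow> f x \<le> B"
  shows "continuous_on UNIV f"
proof -
  define V where "V = {x. x0 + 1 *\<^sub>R x \<in> U} \<inter> {x. x0 + (- 1) *\<^sub>R x \<in> U}"
  define M where "M = max 1 (B - f x0)"
  have V: "open V" "0 \<in> V"
    unfolding V_def by (intro open_Int open_affine_vimage U(1)) (simp add: U(2))
  have M: "M > 0" "\<And>x. x \<in> V \<Longrightarrow> \<bar>f x\<bar> \<le> M"
  proof -
    fix x assume "x \<in> V"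
    then have "f (x0 + x) \<le> B" "f (x0 - x) \<le> B"
      using bound by (auto simp: V_def)
    then show "\<bar>f x\<bar> \<le> M"
      by (auto simp: M_def linear_add[OF f] linear_diff[OF f])
  qed (simp add: M_def)
  show ?thesis
    unfolding continuous_on_topological
  proof (intro ballI allI impI)
    fix x and B :: "real set" assume "open B" "f x \<in> B"
    then obtain d where d: "d > 0" "ball (f x) d \<subseteq> B" by (rule openE)
    define c where "c = 2 * M / d"
    have "c > 0" using M d by (simp add: c_def)
    define W where "W = {z. - (c *\<^sub>R x) + c *\<^sub>R z \<in> V}"
    have "f z \<in> B" if "z \<in> W" for z
    proof -
      have "\<bar>f (c *\<^sub>R (z - x))\<bar> \<le> M"
        using that M(2) by (simp add: W_def algebra_simps)
      then have "c * \<bar>f z - f x\<bar> \<le> M"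
        using \<open>c > 0\<close> by (simp add: linear_cmul[OF f] linear_diff[OF f] abs_mult)
      also have "\<dots> < 2 * M" using M by simp
      also have "\<dots> = c * d" using d by (simp add: c_def)
      finally have "\<bar>f z - f x\<bar> < d" using \<open>c > 0\<close> by simp
      then show ?thesis using d by (auto simp: dist_real_def abs_minus_commute subset_iff)
    qed
    moreover have "open W" "x \<in> W"
      unfolding W_def by (intro open_affine_vimage V(1)) (simp add: V(2))
    ultimately show "\<exists>A. open A \<and> x \<in> A \<and> (\<forall>y\<in>UNIV. y \<in> A \<longrightarrow> f y \<in> B)" by blast
  qed
qed

text \<open>
  This is how scalar data return to \<open>Y\<close>: if \<open>\<phi> k = 1\<close>, then applying \<open>\<phi>\<close> to the operator
  \<open>\<lambda>x. f x *\<^sub>R k\<close> gives \<open>f\<close> back.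
\<close>

lemma cont_lin_rank_one:
  fixes f :: "'x::locally_convex_space \<Rightarrow> real" and k :: "'y::locally_convex_space"
  assumes "linear f" "continuous_on UNIV f"
  shows "(\<lambda>x. f x *\<^sub>R k) \<in> cont_lin"
proof -
  have "linear (\<lambda>x. f x *\<^sub>R k)"
    by (intro linearI) (simp_all add: linear_add[OF assms(1)] linear_cmul[OF assms(1)] scaleR_left_distrib)
  moreover have "continuous_on UNIV (\<lambda>x. f x *\<^sub>R k)"
    by (intro continuous_on_scaleR_locally_convex assms continuous_on_const)
  ultimately show ?thesis by (simp add: cont_lin_def)
qed

lemma cont_lin_diff:
  assumes "L1 \<in> cont_lin" "L2 \<in> cont_lin"
  shows "(\<lambda>x. L1 x - L2 x) \<in> cont_lin"
  using assms by (auto simp: cont_lin_def intro!: linear_compose_sub continuous_on_diff)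

lemma cont_lin_add:
  assumes "L1 \<in> cont_lin" "L2 \<in> cont_lin"
  shows "(\<lambda>x. L1 x + L2 x) \<in> cont_lin"
  using assms by (auto simp: cont_lin_def intro!: linear_compose_add continuous_on_add)


section \<open>Cones with nonempty interior and weak suprema\<close>

lemma mem_uminus_image_iff:
  fixes x :: "'a::group_add"
  shows "x \<in> uminus ` A \<longleftrightarrow> - x \<in> A"
  by (metis image_iff minus_minus)

text \<open>
  As a rewrite rule this replaces the defining equation, which speaks of the reflected interior.
\<close>

lemma cone_less_Fin [simp]: "cone_less K (Fin a) (Fin b) \<longleftrightarrow> b - a \<in> interior K"
  by (simp add: mem_uminus_image_iff)

declare cone_less.simps(1) [simp del]

locale solid_cone =
  fixes K :: "'y::locally_convex_space set"
  assumes cone: "convex_cone K" and solid: "interior K \<noteq> {}"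
begin

lemma interior_in_cone: "a \<in> interior K \<Longrightarrow> a \<in> K"
  by (rule subsetD[OF interior_subset])

lemma interior_add:
  assumes "a \<in> interior K" "b \<in> K"
  shows "a + b \<in> interior K"
proof (rule interiorI)
  show "open {x. - b + 1 *\<^sub>R x \<in> interior K}" by (intro open_affine_vimage open_interior)
  show "a + b \<in> {x. - b + 1 *\<^sub>R x \<in> interior K}" using assms by simp
  show "{x. - b + 1 *\<^sub>R x \<in> interior K} \<subseteq> K"
  proof
    fix x assume "x \<in> {x. - b + 1 *\<^sub>R x \<in> interior K}"
    then have "- b + x \<in> K" using interior_in_cone[of "- b + x"] by simp
    then have "(- b + x) + b \<in> K" by (rule convex_cone_add[OF cone _ assms(2)])
    then show "x \<in> K" by simp
  qed
qed

lemma interior_scale: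
  assumes "a \<in> interior K" "c > 0"
  shows "c *\<^sub>R a \<in> interior K"
proof (rule interiorI)
  show "open {x. 0 + (1 / c) *\<^sub>R x \<in> interior K}" by (intro open_affine_vimage open_interior)
  show "c *\<^sub>R a \<in> {x. 0 + (1 / c) *\<^sub>R x \<in> interior K}" using assms by simp
  show "{x. 0 + (1 / c) *\<^sub>R x \<in> interior K} \<subseteq> K"
  proof
    fix x assume "x \<in> {x. 0 + (1 / c) *\<^sub>R x \<in> interior K}"
    then have "(1 / c) *\<^sub>R x \<in> K" using interior_in_cone[of "(1 / c) *\<^sub>R x"] by simp
    then have "c *\<^sub>R ((1 / c) *\<^sub>R x) \<in> K"
      using assms(2) by (intro convex_cone_scaleR[OF cone, of c "(1 / c) *\<^sub>R x"]) simp_all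
    then show "x \<in> K" using assms(2) by simp
  qed
qed

lemma interior_shrink:
  assumes "a \<in> interior K"
  shows "\<exists>t>0. a - t *\<^sub>R v \<in> interior K"
  using open_absorbs_direction[OF open_interior assms, of "- v"] by simp

lemma interior_absorbs:
  assumes "a \<in> interior K"
  shows "\<exists>t>0. v + t *\<^sub>R a \<in> interior K"
proof -
  obtain t where t: "t > 0" "a + t *\<^sub>R v \<in> interior K"
    using open_absorbs_direction[OF open_interior assms] by blast
  then have "(1 / t) *\<^sub>R (a + t *\<^sub>R v) \<in> interior K" by (intro interior_scale) auto
  then have "v + (1 / t) *\<^sub>R a \<in> interior K" using t by (simp add: algebra_simps)
  then show ?thesis using t by (intro exI[of _ "1 / t"]) simp
qed

lemma convex_interior: "convex (interior K)"
proof (rule convexI)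
  fix x y and u v :: real
  assume *: "x \<in> interior K" "y \<in> interior K" "0 \<le> u" "0 \<le> v" "u + v = 1"
  show "u *\<^sub>R x + v *\<^sub>R y \<in> interior K"
  proof (cases "u = 0")
    case True
    then show ?thesis using * by simp
  next
    case False
    then show ?thesis
      using * by (intro interior_add interior_scale convex_cone_scaleR[OF cone] interior_in_cone) auto
  qed
qed

lemma nonneg_linear_imp_continuous:
  fixes f :: "'y \<Rightarrow> real"
  assumes "linear f" "\<And>k. k \<in> K \<Longrightarrow> 0 \<le> f k"
  shows "continuous_on UNIV f"
proof -
  obtain k0 where k0: "k0 \<in> interior K" using solid by blast
  show ?thesis
  proof (rule linear_bounded_above_imp_continuous[OF assms(1)])
    show "open {x. 0 + (- 1) *\<^sub>R x \<in> interior K}" by (intro open_affine_vimage open_interior)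
    show "- k0 \<in> {x. 0 + (- 1) *\<^sub>R x \<in> interior K}" using k0 by simp
    fix x assume "x \<in> {x. 0 + (- 1) *\<^sub>R x \<in> interior K}"
    then have "0 \<le> f (- x)" by (intro assms(2) interior_in_cone) simp
    then show "f x \<le> 0" by (simp add: linear_neg[OF assms(1)])
  qed
qed

lemma nonneg_linear_pos_interior:
  fixes f :: "'y \<Rightarrow> real"
  assumes f: "linear f" "\<And>k. k \<in> K \<Longrightarrow> 0 \<le> f k" and "f e \<noteq> 0" and k: "k \<in> interior K"
  shows "0 < f k"
proof (rule ccontr)
  assume "\<not> 0 < f k"
  then have "f k = 0" using f(2)[OF interior_in_cone[OF k]] by simp
  have "f v \<le> 0" for v
  proof -
    obtain t where "t > 0" "k - t *\<^sub>R v \<in> interior K" using interior_shrink[OF k] by blast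
    then have "0 \<le> f (k - t *\<^sub>R v)" by (intro f(2) interior_in_cone)
    then show ?thesis
      using \<open>t > 0\<close> \<open>f k = 0\<close> by (simp add: linear_diff[OF f(1)] linear_cmul[OF f(1)] mult_le_0_iff)
  qed
  from this[of e] this[of "- e"] show False using \<open>f e \<noteq> 0\<close> by (simp add: linear_neg[OF f(1)])
qed


text \<open>
  Every line in an interior direction meets a proper nonempty downset and its complement, because
  multiples of an interior direction dominate every vector. Since \<open>D\<close> is open, the supremum of the
  parameters with values in \<open>D\<close> is not attained. This endpoint supplies the points of weak suprema
  constructed below.
\<close>

lemma downset_ray_endpoint:
  assumes D: "open D" "\<And>a k. a \<in> D \<Longrightarrow> k \<in> K \<Longrightarrow> a - k \<in> D" and "D \<noteq> {}" "D \<noteq> UNIV"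
    and k0: "k0 \<in> interior K"
  shows "\<exists>t. y + t *\<^sub>R k0 \<notin> D \<and> (\<forall>s<t. y + s *\<^sub>R k0 \<in> D)"
proof -
  obtain d b where d: "d \<in> D" and b: "b \<notin> D" using assms by blast
  define T where "T = {t. y + t *\<^sub>R k0 \<in> D}"
  have down: "s \<in> T" if "t \<in> T" "s \<le> t" for s t
  proof -
    have "(y + t *\<^sub>R k0) - (t - s) *\<^sub>R k0 \<in> D"
      using that k0 by (intro D(2) convex_cone_scaleR[OF cone] interior_in_cone) (auto simp: T_def)
    then show ?thesis by (simp add: T_def algebra_simps)
  qed
  obtain r where "(d - y) + r *\<^sub>R k0 \<in> interior K" using interior_absorbs[OF k0] by blast
  then have "d - ((d - y) + r *\<^sub>R k0) \<in> D" by (intro D(2) d interior_in_cone)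
  then have ne: "- r \<in> T" by (simp add: T_def)
  obtain r' where r': "(y - b) + r' *\<^sub>R k0 \<in> interior K" using interior_absorbs[OF k0] by blast
  have "r' \<notin> T"
  proof
    assume "r' \<in> T"
    then have "(y + r' *\<^sub>R k0) - ((y - b) + r' *\<^sub>R k0) \<in> D"
      using r' by (intro D(2) interior_in_cone) (auto simp: T_def)
    then show False using b by (simp add: algebra_simps)
  qed
  then have bdd: "bdd_above T"
    using down by (intro bdd_aboveI[of _ r']) (meson le_cases)
  have "y + Sup T *\<^sub>R k0 \<notin> D"
  proof
    assume "y + Sup T *\<^sub>R k0 \<in> D"
    then obtain e where "e > 0" "(y + Sup T *\<^sub>R k0) + e *\<^sub>R k0 \<in> D"
      using open_absorbs_direction[OF D(1)] by blast
    then have "Sup T + e \<in> T" by (simp add: T_def algebra_simps)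
    then have "Sup T + e \<le> Sup T" by (rule cSup_upper[OF _ bdd])
    then show False using \<open>e > 0\<close> by simp
  qed
  moreover have "y + s *\<^sub>R k0 \<in> D" if s: "s < Sup T" for s
  proof -
    have "T \<noteq> {}" using ne by blast
    then obtain t where "t \<in> T" "s < t" using less_cSupD[OF _ s] by auto
    then have "s \<in> T" using down by simp
    then show ?thesis by (simp add: T_def)
  qed
  ultimately show ?thesis by blast
qed


text \<open>
  The set \<open>M - int K\<close>, extended to sets \<open>M\<close> with infinite members. The finite part of the weak
  supremum of \<open>M\<close> is the boundary of this open downset.
\<close>

definition dominated :: "'y extended set \<Rightarrow> 'y set" where
  "dominated M = {a. \<exists>u\<in>M. cone_less K (Fin a) u}"

lemma open_dominated: "open (dominated M)"
proof -
  have "open {a. cone_less K (Fin a) u}" for u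
    using open_affine_vimage[OF open_interior, of _ "- 1" K] by (cases u) auto
  then have "open (\<Union>u\<in>M. {a. cone_less K (Fin a) u})" by blast
  also have "(\<Union>u\<in>M. {a. cone_less K (Fin a) u}) = dominated M"
    by (auto simp: dominated_def)
  finally show ?thesis .
qed

lemma cone_less_diff:
  assumes "cone_less K (Fin a) u" "k \<in> K"
  shows "cone_less K (Fin (a - k)) u"
proof (cases u)
  case (Fin b)
  then have "(b - a) + k \<in> interior K" using assms interior_add by simp
  moreover have "(b - a) + k = b - (a - k)" by simp
  ultimately show ?thesis using Fin by (simp only: cone_less_Fin)
qed (use assms in auto)

lemma dominated_diff: "a \<in> dominated M \<Longrightarrow> k \<in> K \<Longrightarrow> a - k \<in> dominated M"
  using cone_less_diff by (auto simp: dominated_def)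

lemma Fin_mem_WSup:
  assumes "v \<notin> dominated M" "k0 \<in> interior K" "\<forall>t>0. v - t *\<^sub>R k0 \<in> dominated M"
  shows "Fin v \<in> WSup K M"
  unfolding WSup_def mem_Collect_eq
proof (intro conjI ballI allI impI)
  fix u assume "u \<in> M"
  then show "\<not> cone_less K (Fin v) u" using assms(1) by (auto simp: dominated_def)
next
  fix w assume w: "cone_less K w (Fin v)"
  obtain u where u: "u \<in> M" "cone_less K (Fin (v - 1 *\<^sub>R k0)) u"
    using assms(3)[rule_format, of 1] unfolding dominated_def by auto
  show "\<exists>u\<in>M. cone_less K w u"
  proof (cases w)
    case (Fin w')
    then have "v - w' \<in> interior K" using w by simp
    then obtain t where t: "t > 0" "v - w' - t *\<^sub>R k0 \<in> interior K"
      using interior_shrink by blast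
    then have "(v - t *\<^sub>R k0) - (v - w' - t *\<^sub>R k0) \<in> dominated M"
      using assms(3)[rule_format, OF t(1)] t(2) by (blast intro: dominated_diff interior_in_cone)
    then show ?thesis using Fin by (simp add: dominated_def)
  next
    case Pinf
    then show ?thesis using w by simp
  next
    case Minf
    then show ?thesis using u by (cases u) (auto intro!: bexI[of _ u])
  qed
qed

text \<open>
  If everything is dominated, \<^const>\<open>Pinf\<close> itself belongs to the weak supremum; otherwise one moves
  up from \<open>a\<close> in an interior direction until the downset is left.
\<close>

lemma dominated_imp_less_WSup:
  assumes "a \<in> dominated M"
  shows "\<exists>v\<in>WSup K M. cone_less K (Fin a) v"
proof (cases "dominated M = UNIV")
  case True
  have "Pinf \<in> WSup K M"
    unfolding WSup_def mem_Collect_eq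
  proof (intro conjI ballI allI impI)
    fix w assume w: "cone_less K w Pinf"
    obtain u where u: "u \<in> M" "cone_less K (Fin a) u"
      using assms by (auto simp: dominated_def)
    show "\<exists>u\<in>M. cone_less K w u"
    proof (cases w)
      case (Fin w')
      then show ?thesis using True by (auto simp: dominated_def)
    next
      case Minf
      then show ?thesis using u by (cases u) (auto intro!: bexI[of _ u])
    qed (use w in simp)
  qed simp
  then show ?thesis by (intro bexI[of _ Pinf]) auto
next
  case False
  obtain k0 where k0: "k0 \<in> interior K" using solid by blast
  obtain t where t: "a + t *\<^sub>R k0 \<notin> dominated M" "\<And>s. s < t \<Longrightarrow> a + s *\<^sub>R k0 \<in> dominated M"
    using downset_ray_endpoint[of "dominated M" k0 a, OF open_dominated dominated_diff _ False k0] assms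
    by (metis emptyE)
  have "t > 0"
  proof (rule ccontr)
    assume "\<not> t > 0"
    then have "a - (- t) *\<^sub>R k0 \<in> dominated M"
      using k0 assms by (intro dominated_diff convex_cone_scaleR[OF cone] interior_in_cone) auto
    then show False using t by simp
  qed
  have "Fin (a + t *\<^sub>R k0) \<in> WSup K M"
  proof (rule Fin_mem_WSup[OF t(1) k0], intro allI impI)
    fix s :: real assume "s > 0"
    then show "a + t *\<^sub>R k0 - s *\<^sub>R k0 \<in> dominated M"
      using t(2)[of "t - s"] by (simp add: algebra_simps)
  qed
  moreover have "cone_less K (Fin a) (Fin (a + t *\<^sub>R k0))"
    using \<open>t > 0\<close> k0 interior_scale by simp
  ultimately show ?thesis by blast
qed

text \<open>
  The epigraph of a conjugate is defined by the left-hand side; the right-hand side turns it into a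
  condition on each point of the domain separately. From a point that is not dominated one moves down
  in an interior direction until the dominated set is reached.
\<close>

lemma WSup_plus_cone_iff:
  assumes "u0 \<in> M" "u0 \<noteq> Minf"
  shows "Fin y \<in> WSup K M + Fin ` K \<longleftrightarrow> y \<notin> dominated M"
proof
  assume "Fin y \<in> WSup K M + Fin ` K"
  then obtain v k where v: "v \<in> WSup K M" "k \<in> K" "Fin y = v + Fin k"
    by (auto elim!: set_plus_elim)
  then obtain v' where v': "v = Fin v'" "y = v' + k" by (cases v) auto
  show "y \<notin> dominated M"
  proof
    assume "y \<in> dominated M"
    then have "v' \<in> dominated M" using dominated_diff[of y M k] v v' by simp
    then show False using v v' by (auto simp: WSup_def dominated_def)
  qed
next
  assume y: "y \<notin> dominated M"
  obtain k0 where k0: "k0 \<in> interior K" using solid by blast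
  have "dominated M \<noteq> {}"
  proof (cases u0)
    case (Fin m)
    then have "m - k0 \<in> dominated M"
      using assms k0 unfolding dominated_def by (auto intro!: bexI[of _ u0])
    then show ?thesis by blast
  next
    case Pinf
    then have "0 \<in> dominated M"
      using assms unfolding dominated_def by (auto intro!: bexI[of _ u0])
    then show ?thesis by blast
  qed (use assms in simp)
  then obtain t where t: "y + t *\<^sub>R k0 \<notin> dominated M" "\<And>s. s < t \<Longrightarrow> y + s *\<^sub>R k0 \<in> dominated M"
    using downset_ray_endpoint[of "dominated M" k0 y, OF open_dominated dominated_diff _ _ k0] y
    by (metis UNIV_I)
  have "t \<le> 0"
  proof (rule ccontr)
    assume "\<not> t \<le> 0"
    then show False using t(2)[of 0] y by simp
  qed
  have "Fin (y + t *\<^sub>R k0) \<in> WSup K M"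
  proof (rule Fin_mem_WSup[OF t(1) k0], intro allI impI)
    fix s :: real assume "s > 0"
    then show "y + t *\<^sub>R k0 - s *\<^sub>R k0 \<in> dominated M"
      using t(2)[of "t - s"] by (simp add: algebra_simps)
  qed
  moreover have "(- t) *\<^sub>R k0 \<in> K"
    using \<open>t \<le> 0\<close> k0 by (intro convex_cone_scaleR[OF cone] interior_in_cone) auto
  ultimately have "Fin (y + t *\<^sub>R k0) + Fin ((- t) *\<^sub>R k0) \<in> WSup K M + Fin ` K"
    by (intro set_plus_intro imageI)
  then show "Fin y \<in> WSup K M + Fin ` K" by simp
qed

end

section \<open>Separating a convex from a concave function\<close>

lemma nonneg_at_zero_of_affine:
  fixes a b :: real
  assumes "\<And>t. t > 0 \<Longrightarrow> 0 \<le> a + t * b"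
  shows "0 \<le> a"
proof (rule ccontr)
  assume "\<not> 0 \<le> a"
  define t where "t = - a / (2 * (\<bar>b\<bar> + 1))"
  have "t > 0" using \<open>\<not> 0 \<le> a\<close> by (simp add: t_def divide_neg_pos)
  have "t * b \<le> t * (\<bar>b\<bar> + 1)" using \<open>t > 0\<close> by (intro mult_left_mono) auto
  also have "\<dots> = - a / 2" by (simp add: t_def field_simps)
  finally show False using assms[OF \<open>t > 0\<close>] \<open>\<not> 0 \<le> a\<close> by simp
qed

lemma nonneg_slope_of_affine:
  fixes a b :: real
  assumes "\<And>t. t \<ge> 0 \<Longrightarrow> 0 \<le> a + t * b"
  shows "0 \<le> b"
proof (rule ccontr)
  assume "\<not> 0 \<le> b"
  have "0 \<le> a" using assms[of 0] by simp
  have "0 \<le> a + ((a + 1) / (- b)) * b"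
    using \<open>0 \<le> a\<close> \<open>\<not> 0 \<le> b\<close> by (intro assms divide_nonneg_pos) auto
  also have "\<dots> = - 1" using \<open>\<not> 0 \<le> b\<close> by (simp add: field_simps)
  finally show False by simp
qed

text \<open>
  A convex function \<open>f\<close> above a concave function \<open>- q\<close> leaves room for an affine function in between.
  The pairs \<open>(x - x', r)\<close> with \<open>f x + q x' < r\<close> form a convex set without the origin; separating it from
  the origin gives a functional whose graph can be shifted between \<open>- q\<close> and \<open>f\<close>. The bound on
  \<open>f\<close> near a point of the domain of \<open>q\<close> provides the core point, excludes vertical separating
  functionals, and makes the affine function continuous.
\<close>

lemma convex_sandwich:
  fixes f q :: "'x::locally_convex_space \<Rightarrow> real"
  assumes f: "convex_on D f" and q: "convex_on E q"
    and le: "\<And>x. x \<in> D \<Longrightarrow> x \<in> E \<Longrightarrow> 0 \<le> f x + q x"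
    and x0: "x0 \<in> E" and U: "open U" "x0 \<in> U" "U \<subseteq> D" and bound: "\<And>x. x \<in> U \<Longrightarrow> f x \<le> B"
  obtains a \<beta> where "linear a" "continuous_on UNIV a"
    "\<And>x. x \<in> D \<Longrightarrow> a x - \<beta> \<le> f x" "\<And>x. x \<in> E \<Longrightarrow> - q x \<le> a x - \<beta>"
proof -
  define W where "W = {(u, r) | u r. \<exists>x\<in>D. \<exists>x'\<in>E. u = x - x' \<and> f x + q x' < r}"
  have W_I: "(x - x', r) \<in> W" if "x \<in> D" "x' \<in> E" "f x + q x' < r" for x x' r
    using that by (auto simp: W_def)
  have "convex W"
  proof (rule convexI)
    fix w w' and s t :: real
    assume "w \<in> W" "w' \<in> W" and st: "0 \<le> s" "0 \<le> t" "s + t = 1"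
    then obtain x1 y1 r1 x2 y2 r2
      where w: "w = (x1 - y1, r1)" "x1 \<in> D" "y1 \<in> E" "f x1 + q y1 < r1"
        and w': "w' = (x2 - y2, r2)" "x2 \<in> D" "y2 \<in> E" "f x2 + q y2 < r2"
      unfolding W_def by blast
    let ?x = "s *\<^sub>R x1 + t *\<^sub>R x2" and ?y = "s *\<^sub>R y1 + t *\<^sub>R y2"
    have xy: "?x \<in> D" "?y \<in> E"
      using f q w w' st by (auto simp: convex_on_def intro!: convexD)
    have "f ?x \<le> s * f x1 + t * f x2" "q ?y \<le> s * q y1 + t * q y2"
      using f q w w' st by (auto simp: convex_on_def)
    then have "f ?x + q ?y \<le> s * (f x1 + q y1) + t * (f x2 + q y2)"
      by (simp add: algebra_simps)
    also have "\<dots> < s * r1 + t * r2"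
    proof (cases "s = 0")
      case True
      then show ?thesis using st w' by simp
    next
      case False
      then show ?thesis using st w w'
        by (intro add_less_le_mono mult_strict_left_mono mult_left_mono) auto
    qed
    finally have "(?x - ?y, s * r1 + t * r2) \<in> W" using xy by (intro W_I)
    moreover have "(?x - ?y, s * r1 + t * r2) = s *\<^sub>R w + t *\<^sub>R w'"
      by (simp add: w(1) w'(1) algebra_simps)
    ultimately show "s *\<^sub>R w + t *\<^sub>R w' \<in> W" by metis
  qed
  moreover have "0 \<notin> W"
  proof
    assume "0 \<in> W"
    then obtain x x' where "x \<in> D" "x' \<in> E" "0 = x - x'" "f x + q x' < 0"
      unfolding W_def zero_prod_def by blast
    then show False using le[of x] by simp
  qed
  moreover
  \<comment> \<open>Positivity of \<open>r0\<close> is what later makes the separating functional non-vertical.\<close>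
  define r0 where "r0 = max 1 (B + q x0 + 1)"
  have r0: "r0 > 0" "B + q x0 < r0" by (auto simp: r0_def)
  have x0D: "x0 \<in> D" using U by blast
  have "(0, r0) \<in> W"
    using W_I[OF x0D x0, of r0] bound[OF U(2)] r0 by simp
  moreover have "\<exists>t>0. (0, r0) + t *\<^sub>R v \<in> W" for v
  proof -
    obtain u r where v: "v = (u, r)" by (cases v)
    have "\<forall>\<^sub>F t in at_right 0. x0 + t *\<^sub>R u \<in> U \<and> r0 + t *\<^sub>R r \<in> {B + q x0<..}"
      using r0 by (intro eventually_conj eventually_open_direction U open_greaterThan) auto
    then obtain t where t: "t > 0" "x0 + t *\<^sub>R u \<in> U" "r0 + t *\<^sub>R r \<in> {B + q x0<..}"
      using eventually_at_right_0_obtains by blast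
    then have "((x0 + t *\<^sub>R u) - x0, r0 + t * r) \<in> W"
      using bound[OF t(2)] U x0 by (intro W_I) auto
    then show ?thesis using t(1) by (auto simp: v)
  qed
  ultimately obtain h :: "'x \<times> real \<Rightarrow> real"
    where h: "linear h" "h (0, r0) = 1" "\<And>w. w \<in> W \<Longrightarrow> 0 \<le> h w"
    using separation_at_core_point[of W "(0, r0)"] by metis
  have h_split: "h (u, r) = h (u, 0) + r / r0" for u r
  proof -
    have "h (u, r) = h ((u, 0) + (r / r0) *\<^sub>R (0, r0))" using r0 by simp
    also have "\<dots> = h (u, 0) + (r / r0) * h (0, r0)"
      by (simp only: linear_add[OF h(1)] linear_cmul[OF h(1)] real_scaleR_def)
    finally show ?thesis using h(2) by simp
  qed
  define a where "a u = - r0 * h (u, 0)" for u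
  have a: "linear a"
  proof (rule linearI)
    fix u v and c :: real
    have "h (u + v, 0) = h ((u, 0) + (v, 0))" by simp
    then show "a (u + v) = a u + a v"
      by (simp only: a_def linear_add[OF h(1)]) (simp add: algebra_simps)
    have "h (c *\<^sub>R u, 0) = h (c *\<^sub>R (u, 0))" by simp
    then show "a (c *\<^sub>R u) = c *\<^sub>R a u"
      by (simp only: a_def linear_cmul[OF h(1)]) simp
  qed
  have key: "a x - f x \<le> a x' + q x'" if "x \<in> D" "x' \<in> E" for x x'
  proof -
    have "a x - a x' \<le> r" if "f x + q x' < r" for r
    proof -
      have "0 \<le> h (x - x', 0) + r / r0"
        using h(3)[OF W_I[OF \<open>x \<in> D\<close> \<open>x' \<in> E\<close> that]] h_split[of "x - x'" r] by simp
      then have "0 \<le> r0 * (h (x - x', 0) + r / r0)" using r0 by (intro mult_nonneg_nonneg) auto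
      also have "\<dots> = - a (x - x') + r" using r0 by (simp add: a_def field_simps)
      finally show ?thesis by (simp add: linear_diff[OF a])
    qed
    then have "a x - a x' \<le> f x + q x'" by (rule dense_ge)
    then show ?thesis by simp
  qed
  define \<beta> where "\<beta> = Sup ((\<lambda>x. a x - f x) ` D)"
  have "bdd_above ((\<lambda>x. a x - f x) ` D)"
    using key[OF _ x0] by (intro bdd_aboveI2) auto
  then have lower: "a x - f x \<le> \<beta>" if "x \<in> D" for x
    unfolding \<beta>_def using that by (intro cSup_upper) auto
  have upper: "\<beta> \<le> a x' + q x'" if "x' \<in> E" for x'
    unfolding \<beta>_def using key[OF _ that] x0D by (intro cSup_least) auto
  have "continuous_on UNIV a"
  proof (rule linear_bounded_above_imp_continuous[OF a U(1,2)])
    fix x assume "x \<in> U"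
    then show "a x \<le> B + \<beta>" using lower[of x] bound[of x] U(3) by force
  qed
  show ?thesis
  proof (rule that[of a \<beta>])
    show "a x - \<beta> \<le> f x" if "x \<in> D" for x using lower[OF that] by simp
    show "- q x \<le> a x - \<beta>" if "x \<in> E" for x using upper[OF that] by simp
  qed fact+
qed


section \<open>Scalarization\<close>

lemma cone_convexD:
  assumes "cone_convex K H" "convex_cone K" "H x = Fin h" "H x' = Fin h'"
    and "0 \<le> u" "0 \<le> v" "u + v = 1"
  shows "\<exists>h''. H (u *\<^sub>R x + v *\<^sub>R x') = Fin h'' \<and> u *\<^sub>R h + v *\<^sub>R h' - h'' \<in> K"
proof -
  let ?E = "{(x, y). \<exists>h. H x = Fin h \<and> cone_le K h y}"
  have "(x, h) \<in> ?E" "(x', h') \<in> ?E"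
    using assms(3,4) convex_cone_contains_0[OF assms(2)]
    by (auto simp: cone_le_def mem_uminus_image_iff)
  then have "u *\<^sub>R (x, h) + v *\<^sub>R (x', h') \<in> ?E"
    using assms by (intro convexD) (auto simp: cone_convex_def)
  then show ?thesis by (auto simp: cone_le_def mem_uminus_image_iff)
qed

definition fin_dom :: "('x \<Rightarrow> 'y extended) \<Rightarrow> 'x set" where
  "fin_dom H = {x. \<exists>h. H x = Fin h}"

text \<open>
  Only the values on \<^const>\<open>fin_dom\<close> matter; \<open>0\<close> is a default at infinite points.
\<close>

definition scalarized :: "('y \<Rightarrow> real) \<Rightarrow> ('x \<Rightarrow> 'y extended) \<Rightarrow> 'x \<Rightarrow> real" where
  "scalarized \<phi> H x = (case H x of Fin h \<Rightarrow> \<phi> h | _ \<Rightarrow> 0)"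

lemma scalarized_Fin: "H x = Fin h \<Longrightarrow> scalarized \<phi> H x = \<phi> h"
  by (simp add: scalarized_def)

lemma convex_on_scalarized:
  assumes H: "cone_convex K H" "convex_cone K" and \<phi>: "linear \<phi>" "\<And>k. k \<in> K \<Longrightarrow> 0 \<le> \<phi> k"
  shows "convex_on (fin_dom H) (scalarized \<phi> H)"
  unfolding convex_on_def
proof (intro conjI ballI allI impI)
  show "convex (fin_dom H)"
  proof (rule convexI)
    fix x x' and u v :: real
    assume *: "x \<in> fin_dom H" "x' \<in> fin_dom H" "0 \<le> u" "0 \<le> v" "u + v = 1"
    then obtain h h' where "H x = Fin h" "H x' = Fin h'" by (auto simp: fin_dom_def)
    from cone_convexD[OF H this *(3-5)] show "u *\<^sub>R x + v *\<^sub>R x' \<in> fin_dom H"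
      by (auto simp: fin_dom_def)
  qed
next
  fix x x' and u v :: real
  assume *: "x \<in> fin_dom H" "x' \<in> fin_dom H" "0 \<le> u" "0 \<le> v" "u + v = 1"
  then obtain h h' where h: "H x = Fin h" "H x' = Fin h'" by (auto simp: fin_dom_def)
  from cone_convexD[OF H this *(3-5)] obtain h''
    where h'': "H (u *\<^sub>R x + v *\<^sub>R x') = Fin h''" "u *\<^sub>R h + v *\<^sub>R h' - h'' \<in> K" by blast
  have "0 \<le> \<phi> (u *\<^sub>R h + v *\<^sub>R h' - h'')" by (rule \<phi>(2)[OF h''(2)])
  then show "scalarized \<phi> H (u *\<^sub>R x + v *\<^sub>R x') \<le> u * scalarized \<phi> H x + v * scalarized \<phi> H x'"
    by (simp add: scalarized_Fin[of H _ h''] scalarized_Fin[of H _ h] scalarized_Fin[of H _ h'] h h''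
      linear_add[OF \<phi>(1)] linear_diff[OF \<phi>(1)] linear_cmul[OF \<phi>(1)])
qed

lemma scalarized_bounded_near:
  assumes H: "ext_continuous_at H x" and \<phi>: "continuous_on UNIV \<phi>"
  obtains U B where "open U" "x \<in> U" "U \<subseteq> fin_dom H" "\<And>z. z \<in> U \<Longrightarrow> scalarized \<phi> H z \<le> B"
proof -
  obtain h where h: "H x = Fin h"
    "\<And>V. open V \<Longrightarrow> h \<in> V \<Longrightarrow> \<exists>U. open U \<and> x \<in> U \<and> H ` U \<subseteq> Fin ` V"
    using H by (auto simp: ext_continuous_at_def)
  have "open (\<phi> -` {..<\<phi> h + 1})" by (rule open_vimage[OF open_lessThan \<phi>])
  then obtain U where U: "open U" "x \<in> U" "H ` U \<subseteq> Fin ` (\<phi> -` {..<\<phi> h + 1})"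
    using h(2)[of "\<phi> -` {..<\<phi> h + 1}"] by auto
  have *: "\<exists>w. H z = Fin w \<and> \<phi> w < \<phi> h + 1" if "z \<in> U" for z
    using U(3) that by auto
  show ?thesis
  proof (rule that[OF U(1,2), of "\<phi> h + 1"])
    show "U \<subseteq> fin_dom H" using * by (force simp: fin_dom_def)
    show "scalarized \<phi> H z \<le> \<phi> h + 1" if "z \<in> U" for z
      using *[OF that] by (auto simp: scalarized_Fin)
  qed
qed

lemma convex_on_diff_linear:
  assumes "convex_on D f" "linear l"
  shows "convex_on D (\<lambda>x. f x + (c - l x))"
  unfolding convex_on_def
proof (intro conjI ballI allI impI)
  show "convex D" using assms(1) by (simp add: convex_on_def)
next
  fix x y and u v :: real
  assume *: "x \<in> D" "y \<in> D" "0 \<le> u" "0 \<le> v" "u + v = 1"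
  have "f (u *\<^sub>R x + v *\<^sub>R y) \<le> u * f x + v * f y"
    using assms(1) * by (simp add: convex_on_def)
  moreover have "c = (u + v) * c" using * by simp
  ultimately show "f (u *\<^sub>R x + v *\<^sub>R y) + (c - l (u *\<^sub>R x + v *\<^sub>R y)) \<le> u * (f x + (c - l x)) + v * (f y + (c - l y))"
    by (simp add: linear_add[OF assms(2)] linear_cmul[OF assms(2)] algebra_simps)
qed

context solid_cone
begin

definition scalarizing :: "('y \<Rightarrow> real) \<Rightarrow> bool" where
  "scalarizing \<phi> \<longleftrightarrow> linear \<phi> \<and> (\<forall>k\<in>interior K. 0 < \<phi> k)"

lemma scalarizing_nonneg:
  assumes "scalarizing \<phi>" "k \<in> K"
  shows "0 \<le> \<phi> k"
proof -
  obtain k0 where k0: "k0 \<in> interior K" using solid by blast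
  have \<phi>: "linear \<phi>" using assms by (simp add: scalarizing_def)
  show ?thesis
  proof (rule nonneg_at_zero_of_affine)
    fix t :: real assume "t > 0"
    then have "t *\<^sub>R k0 + k \<in> interior K" using k0 assms by (intro interior_add interior_scale)
    then have "0 < \<phi> (t *\<^sub>R k0 + k)" using assms by (simp add: scalarizing_def)
    then show "0 \<le> \<phi> k + t * \<phi> k0" by (simp add: linear_add[OF \<phi>] linear_cmul[OF \<phi>])
  qed
qed

lemma scalarizing_unit:
  assumes "scalarizing \<phi>"
  obtains k where "k \<in> interior K" "\<phi> k = 1"
proof -
  obtain k0 where k0: "k0 \<in> interior K" using solid by blast
  have \<phi>: "linear \<phi>" "0 < \<phi> k0" using assms k0 by (auto simp: scalarizing_def)
  show ?thesis
    using \<phi> k0 by (intro that[of "(1 / \<phi> k0) *\<^sub>R k0"] interior_scale) (auto simp: linear_cmul[OF \<phi>(1)])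
qed

text \<open>
  The Lagrange multiplier rule. The hypothesis \<open>no\<close> says that the origin of \<open>Y \<times> Z\<close> is not in the
  convex set \<open>E\<close> of all pairs lying strictly above \<open>y - L x + F x\<close> in the first and weakly above \<open>G x\<close>
  in the second component, for some \<open>x \<in> C\<close>. A functional that is nonnegative on \<open>E\<close> splits into \<open>\<phi>\<close>
  and \<open>\<psi>\<close>, both nonnegative on the cones because \<open>E\<close> is stable under adding elements of \<open>K \<times> S\<close>. The Slater point makes \<open>(e, 0)\<close> a
  core point of \<open>E\<close>; as the functional is normalized there, \<open>\<phi> e = 1\<close> and \<open>\<phi>\<close> is not zero.
\<close>

lemma scalar_multipliers:
  fixes F :: "'x::locally_convex_space \<Rightarrow> 'y extended" and G :: "'x \<Rightarrow> 'z::locally_convex_space extended"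
  assumes S: "convex_cone S" and F: "cone_convex K F" and G: "cone_convex S G" and C: "convex C"
    and L: "linear L"
    and slater: "x1 \<in> C" "F x1 = Fin f1" "G x1 = Fin g1" "- g1 \<in> interior S"
    and no: "\<And>x f g. x \<in> C \<Longrightarrow> F x = Fin f \<Longrightarrow> G x = Fin g \<Longrightarrow> - g \<in> S \<Longrightarrow> L x - f - y \<notin> interior K"
  obtains \<phi> \<psi> where "scalarizing \<phi>" "linear \<psi>" "\<And>s. s \<in> S \<Longrightarrow> 0 \<le> \<psi> s"
    "\<And>x f g. x \<in> C \<Longrightarrow> F x = Fin f \<Longrightarrow> G x = Fin g \<Longrightarrow> \<phi> (L x - f) - \<psi> g \<le> \<phi> y"
proof -
  obtain k0 where k0: "k0 \<in> interior K" using solid by blast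
  define E where "E = {(v, z) | v z. \<exists>x\<in>C. \<exists>f g. F x = Fin f \<and> G x = Fin g \<and>
    v - (y - L x + f) \<in> interior K \<and> z - g \<in> S}"
  have E_I: "(v, z) \<in> E" if "x \<in> C" "F x = Fin f" "G x = Fin g" "v - (y - L x + f) \<in> interior K" "z - g \<in> S"
    for v z x f g
    using that unfolding E_def by blast
  have "convex E"
  proof (rule convexI)
    fix w w' and s t :: real
    assume "w \<in> E" "w' \<in> E" and st: "0 \<le> s" "0 \<le> t" "s + t = 1"
    then obtain v z x f g v' z' x' f' g'
      where w: "w = (v, z)" "x \<in> C" "F x = Fin f" "G x = Fin g" "v - (y - L x + f) \<in> interior K" "z - g \<in> S"
        and w': "w' = (v', z')" "x' \<in> C" "F x' = Fin f'" "G x' = Fin g'"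
          "v' - (y - L x' + f') \<in> interior K" "z' - g' \<in> S"
      unfolding E_def by blast
    let ?x = "s *\<^sub>R x + t *\<^sub>R x'"
    obtain f'' where f'': "F ?x = Fin f''" "s *\<^sub>R f + t *\<^sub>R f' - f'' \<in> K"
      using cone_convexD[OF F cone w(3) w'(3) st] by blast
    obtain g'' where g'': "G ?x = Fin g''" "s *\<^sub>R g + t *\<^sub>R g' - g'' \<in> S"
      using cone_convexD[OF G S w(4) w'(4) st] by blast
    have "s *\<^sub>R (v - (y - L x + f)) + t *\<^sub>R (v' - (y - L x' + f')) \<in> interior K"
      by (rule convexD[OF convex_interior w(5) w'(5) st])
    then have 1: "s *\<^sub>R (v - (y - L x + f)) + t *\<^sub>R (v' - (y - L x' + f')) + (s *\<^sub>R f + t *\<^sub>R f' - f'') \<in> interior K"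
      by (rule interior_add) (rule f'')
    have y: "y = s *\<^sub>R y + t *\<^sub>R y" using st by (metis scaleR_left_distrib scaleR_one)
    have "s *\<^sub>R (v - (y - L x + f)) + t *\<^sub>R (v' - (y - L x' + f')) + (s *\<^sub>R f + t *\<^sub>R f' - f'')
      = s *\<^sub>R v + t *\<^sub>R v' - ((s *\<^sub>R y + t *\<^sub>R y) - L ?x + f'')"
      by (simp add: linear_add[OF L] linear_cmul[OF L] algebra_simps)
    with 1 y have 2: "s *\<^sub>R v + t *\<^sub>R v' - (y - L ?x + f'') \<in> interior K" by metis
    have "s *\<^sub>R (z - g) + t *\<^sub>R (z' - g') + (s *\<^sub>R g + t *\<^sub>R g' - g'') \<in> S"
      using w w' st g'' by (intro convex_cone_add[OF S] convex_cone_scaleR[OF S])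
    then have 3: "s *\<^sub>R z + t *\<^sub>R z' - g'' \<in> S" by (simp add: algebra_simps)
    have "?x \<in> C" by (rule convexD[OF C w(2) w'(2) st])
    from E_I[OF this f''(1) g''(1) 2 3] show "s *\<^sub>R w + t *\<^sub>R w' \<in> E"
      by (simp add: w(1) w'(1))
  qed
  moreover have "0 \<notin> E"
  proof
    assume "0 \<in> E"
    then obtain x f g where "x \<in> C" "F x = Fin f" "G x = Fin g" "0 - (y - L x + f) \<in> interior K" "0 - g \<in> S"
      unfolding E_def zero_prod_def by blast
    then show False using no[of x f g] by (simp add: algebra_simps)
  qed
  moreover
  define e where "e = y - L x1 + f1 + k0"
  have g1: "- g1 \<in> S" using slater(4) interior_subset by blast
  have e_I: "(e + k, s) \<in> E" if "k0 + k \<in> interior K" "s - g1 \<in> S" for k s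
    using that by (intro E_I[OF slater(1-3)]) (simp_all add: e_def algebra_simps)
  have "(e, 0) \<in> E" using e_I[of 0 0] k0 g1 by simp
  moreover have "\<exists>t>0. (e, 0) + t *\<^sub>R w \<in> E" for w
  proof -
    obtain v z where w: "w = (v, z)" by (cases w)
    have "\<forall>\<^sub>F t in at_right 0. k0 + t *\<^sub>R v \<in> interior K \<and> - g1 + t *\<^sub>R z \<in> interior S"
      by (intro eventually_conj eventually_open_direction open_interior k0 slater)
    then obtain t where t: "t > 0" "k0 + t *\<^sub>R v \<in> interior K" "- g1 + t *\<^sub>R z \<in> interior S"
      using eventually_at_right_0_obtains by blast
    have "t *\<^sub>R z - g1 \<in> S" using subsetD[OF interior_subset t(3)] by simp
    from e_I[OF t(2) this] show ?thesis using t(1) by (auto simp: w)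
  qed
  ultimately obtain h :: "'y \<times> 'z \<Rightarrow> real"
    where h: "linear h" "h (e, 0) = 1" "\<And>w. w \<in> E \<Longrightarrow> 0 \<le> h w"
    using separation_at_core_point[of E "(e, 0)"] by metis
  define \<phi> \<psi> where "\<phi> v = h (v, 0)" and "\<psi> z = h (0, z)" for v z
  have \<phi>: "linear \<phi>"
  proof (rule linearI)
    fix u v and c :: real
    show "\<phi> (u + v) = \<phi> u + \<phi> v"
      using linear_add[OF h(1), of "(u, 0)" "(v, 0)"] by (simp add: \<phi>_def)
    show "\<phi> (c *\<^sub>R u) = c *\<^sub>R \<phi> u"
      using linear_cmul[OF h(1), of c "(u, 0)"] by (simp add: \<phi>_def)
  qed
  have \<psi>: "linear \<psi>"
  proof (rule linearI)
    fix u v and c :: real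
    show "\<psi> (u + v) = \<psi> u + \<psi> v"
      using linear_add[OF h(1), of "(0, u)" "(0, v)"] by (simp add: \<psi>_def)
    show "\<psi> (c *\<^sub>R u) = c *\<^sub>R \<psi> u"
      using linear_cmul[OF h(1), of c "(0, u)"] by (simp add: \<psi>_def)
  qed
  have E_nonneg: "0 \<le> \<phi> v + \<psi> z" if "(v, z) \<in> E" for v z
    using h(3)[OF that] linear_add[OF h(1), of "(v, 0)" "(0, z)"] by (simp add: \<phi>_def \<psi>_def)
  have \<phi>_nonneg: "0 \<le> \<phi> k" if "k \<in> K" for k
  proof (rule nonneg_slope_of_affine)
    fix t :: real assume "t \<ge> 0"
    then have "t *\<^sub>R k \<in> K" using that by (intro convex_cone_scaleR[OF cone])
    then have "(e + t *\<^sub>R k, 0) \<in> E" using k0 g1 by (intro e_I interior_add) auto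
    then show "0 \<le> \<phi> e + t * \<phi> k"
      using E_nonneg by (fastforce simp: linear_add[OF \<phi>] linear_cmul[OF \<phi>] linear_0[OF \<psi>])
  qed
  have \<psi>_nonneg: "0 \<le> \<psi> s" if "s \<in> S" for s
  proof (rule nonneg_slope_of_affine)
    fix t :: real assume "t \<ge> 0"
    then have "t *\<^sub>R s + - g1 \<in> S" using that g1 by (intro convex_cone_add[OF S] convex_cone_scaleR[OF S])
    then have "(e + 0, t *\<^sub>R s) \<in> E" using k0 by (intro e_I) auto
    then show "0 \<le> \<phi> e + t * \<psi> s"
      using E_nonneg by (fastforce simp: linear_cmul[OF \<psi>])
  qed
  have "scalarizing \<phi>"
    unfolding scalarizing_def
    using \<phi> \<phi>_nonneg h(2) nonneg_linear_pos_interior[of \<phi> e] by (auto simp: \<phi>_def)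
  moreover have "\<phi> (L x - f) - \<psi> g \<le> \<phi> y" if x: "x \<in> C" "F x = Fin f" "G x = Fin g" for x f g
  proof -
    have "0 \<le> \<phi> (y - L x + f) + \<psi> g"
    proof (rule nonneg_at_zero_of_affine)
      fix t :: real assume "t > 0"
      then have "(y - L x + f + t *\<^sub>R k0, g) \<in> E"
        using k0 convex_cone_contains_0[OF S] by (intro E_I[OF x]) (auto intro: interior_scale)
      then have "0 \<le> \<phi> (y - L x + f + t *\<^sub>R k0) + \<psi> g" by (rule E_nonneg)
      then show "0 \<le> \<phi> (y - L x + f) + \<psi> g + t * \<phi> k0"
        by (simp only: linear_add[OF \<phi>] linear_cmul[OF \<phi>]) simp
    qed
    then show ?thesis by (simp add: linear_add[OF \<phi>] linear_diff[OF \<phi>])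
  qed
  ultimately show ?thesis using that[of \<phi> \<psi>] \<psi> \<psi>_nonneg by blast
qed

end

section \<open>Hyperplanes in the family of partitioning sets\<close>

text \<open>
  The level sets of a scalarizing functional are the only members of \<^term>\<open>Pp K\<close> that have to be
  exhibited. They are their own weak suprema, and their levels add up under \<^const>\<open>ws_sum\<close>.
\<close>

definition hyperplane :: "('y \<Rightarrow> real) \<Rightarrow> real \<Rightarrow> 'y extended set" where
  "hyperplane \<phi> \<alpha> = Fin ` {v. \<phi> v = \<alpha>}"

lemma Fin_mem_hyperplane [simp]: "Fin v \<in> hyperplane \<phi> \<alpha> \<longleftrightarrow> \<phi> v = \<alpha>"
  by (auto simp: hyperplane_def)

context solid_cone
begin

lemma hyperplane_reached:
  assumes "scalarizing \<phi>" "\<phi> v < \<alpha>"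
  shows "\<exists>k\<in>interior K. \<phi> (v + k) = \<alpha>"
proof -
  have \<phi>: "linear \<phi>" using assms by (simp add: scalarizing_def)
  obtain k where "k \<in> interior K" "\<phi> k = 1" using scalarizing_unit[OF assms(1)] .
  then show ?thesis
    using assms(2) by (intro bexI[of _ "(\<alpha> - \<phi> v) *\<^sub>R k"] interior_scale) (auto simp: linear_add[OF \<phi>] linear_cmul[OF \<phi>])
qed

lemma hyperplane_reached_from_above:
  assumes "scalarizing \<phi>" "\<alpha> < \<phi> v"
  shows "\<exists>k\<in>interior K. \<phi> (v - k) = \<alpha>"
proof -
  have \<phi>: "linear \<phi>" using assms by (simp add: scalarizing_def)
  obtain k where "k \<in> interior K" "\<phi> k = 1" using scalarizing_unit[OF assms(1)] .
  then show ?thesis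
    using assms(2) by (intro bexI[of _ "(\<phi> v - \<alpha>) *\<^sub>R k"] interior_scale) (auto simp: linear_diff[OF \<phi>] linear_cmul[OF \<phi>])
qed

lemma hyperplane_nonempty:
  assumes "scalarizing \<phi>"
  shows "\<exists>v. \<phi> v = \<alpha>"
proof -
  have \<phi>: "linear \<phi>" using assms by (simp add: scalarizing_def)
  obtain k where "k \<in> interior K" "\<phi> k = 1" using scalarizing_unit[OF assms(1)] .
  then show ?thesis by (intro exI[of _ "\<alpha> *\<^sub>R k"]) (simp add: linear_cmul[OF \<phi>])
qed

lemma scalarizing_less:
  assumes "scalarizing \<phi>" "b - a \<in> interior K"
  shows "\<phi> a < \<phi> b"
proof -
  have \<phi>: "linear \<phi>" "0 < \<phi> (b - a)" using assms by (auto simp: scalarizing_def)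
  then show ?thesis by (simp add: linear_diff[OF \<phi>(1)])
qed

lemma hyperplane_in_Pp:
  assumes \<phi>: "scalarizing \<phi>"
  shows "hyperplane \<phi> \<alpha> \<in> Pp K"
proof -
  let ?U = "{v. \<phi> v = \<alpha>}"
  have below: "?U + uminus ` interior K = {v. \<phi> v < \<alpha>}"
  proof (intro subset_antisym subsetI)
    fix v assume "v \<in> ?U + uminus ` interior K"
    then obtain u k where "\<phi> u = \<alpha>" "k \<in> interior K" "v = u + - k" by (auto elim!: set_plus_elim)
    then show "v \<in> {v. \<phi> v < \<alpha>}" using scalarizing_less[OF \<phi>, of u v] by simp
  next
    fix v assume "v \<in> {v. \<phi> v < \<alpha>}"
    then obtain k where "k \<in> interior K" "\<phi> (v + k) = \<alpha>" using hyperplane_reached[OF \<phi>] by blast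
    then have "(v + k) + - k \<in> ?U + uminus ` interior K" by (intro set_plus_intro imageI) auto
    then show "v \<in> ?U + uminus ` interior K" by simp
  qed
  have above: "?U + interior K = {v. \<alpha> < \<phi> v}"
  proof (intro subset_antisym subsetI)
    fix v assume "v \<in> ?U + interior K"
    then obtain u k where "\<phi> u = \<alpha>" "k \<in> interior K" "v = u + k" by (auto elim!: set_plus_elim)
    then show "v \<in> {v. \<alpha> < \<phi> v}" using scalarizing_less[OF \<phi>, of v u] by simp
  next
    fix v assume "v \<in> {v. \<alpha> < \<phi> v}"
    then obtain k where "k \<in> interior K" "\<phi> (v - k) = \<alpha>" using hyperplane_reached_from_above[OF \<phi>] by blast
    then have "(v - k) + k \<in> ?U + interior K" by (intro set_plus_intro) auto
    then show "v \<in> ?U + interior K" by simp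
  qed
  show ?thesis
    unfolding Pp_def hyperplane_def mem_Collect_eq
    by (intro exI[of _ ?U]) (auto simp: below above)
qed

lemma WSup_hyperplane:
  assumes \<phi>: "scalarizing \<phi>"
  shows "WSup K (hyperplane \<phi> \<alpha>) = hyperplane \<phi> \<alpha>"
proof (intro subset_antisym subsetI)
  fix v assume v: "v \<in> WSup K (hyperplane \<phi> \<alpha>)"
  have not_less: "\<not> cone_less K v (Fin u)" if "\<phi> u = \<alpha>" for u
    using v that unfolding WSup_def by (auto simp: hyperplane_def)
  have approx: "\<exists>u. \<phi> u = \<alpha> \<and> cone_less K w (Fin u)" if "cone_less K w v" for w
    using v that unfolding WSup_def by (auto simp: hyperplane_def)
  have not_below: False if less: "cone_less K (Fin w) v" and w: "\<phi> w = \<alpha>" for w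
  proof -
    obtain u where "\<phi> u = \<alpha>" "cone_less K (Fin w) (Fin u)" using approx[OF less] by blast
    then show False using scalarizing_less[OF \<phi>, of u w] w by simp
  qed
  obtain w0 where w0: "\<phi> w0 = \<alpha>" using hyperplane_nonempty[OF \<phi>] by blast
  show "v \<in> hyperplane \<phi> \<alpha>"
  proof (cases v)
    case (Fin a)
    have "\<not> \<phi> a < \<alpha>"
      using hyperplane_reached[OF \<phi>, of a \<alpha>] not_less Fin by force
    moreover have "\<not> \<alpha> < \<phi> a"
    proof
      assume "\<alpha> < \<phi> a"
      then obtain k where "k \<in> interior K" "\<phi> (a - k) = \<alpha>" using hyperplane_reached_from_above[OF \<phi>] by blast
      then show False using not_below[of "a - k"] Fin by simp
    qed
    ultimately show ?thesis using Fin by simp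
  next
    case Pinf
    then show ?thesis using not_below[of w0] w0 by simp
  next
    case Minf
    then show ?thesis using not_less[OF w0] by simp
  qed
next
  fix v assume "v \<in> hyperplane \<phi> \<alpha>"
  then obtain a where a: "v = Fin a" "\<phi> a = \<alpha>" by (auto simp: hyperplane_def)
  show "v \<in> WSup K (hyperplane \<phi> \<alpha>)"
    unfolding WSup_def mem_Collect_eq
  proof (intro conjI ballI allI impI)
    fix u assume "u \<in> hyperplane \<phi> \<alpha>"
    then show "\<not> cone_less K v u"
      using a scalarizing_less[OF \<phi>, of _ a] by (force simp: hyperplane_def)
  next
    fix w assume "cone_less K w v"
    then show "\<exists>u\<in>hyperplane \<phi> \<alpha>. cone_less K w u" using a by (intro bexI[of _ v]) auto
  qed
qed

lemma ws_sum_hyperplane: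
  assumes \<phi>: "scalarizing \<phi>"
  shows "ws_sum K (hyperplane \<phi> \<alpha>) (hyperplane \<phi> \<beta>) = hyperplane \<phi> (\<alpha> + \<beta>)"
proof -
  have lin: "linear \<phi>" using \<phi> by (simp add: scalarizing_def)
  have "hyperplane \<phi> \<alpha> + hyperplane \<phi> \<beta> = hyperplane \<phi> (\<alpha> + \<beta>)"
  proof (intro subset_antisym subsetI)
    fix v assume "v \<in> hyperplane \<phi> \<alpha> + hyperplane \<phi> \<beta>"
    then show "v \<in> hyperplane \<phi> (\<alpha> + \<beta>)"
      by (auto elim!: set_plus_elim simp: hyperplane_def linear_add[OF lin])
  next
    fix v assume "v \<in> hyperplane \<phi> (\<alpha> + \<beta>)"
    then obtain a where a: "v = Fin a" "\<phi> a = \<alpha> + \<beta>" by (auto simp: hyperplane_def)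
    obtain b where b: "\<phi> b = \<alpha>" using hyperplane_nonempty[OF \<phi>] by blast
    have "Fin b + Fin (a - b) \<in> hyperplane \<phi> \<alpha> + hyperplane \<phi> \<beta>"
      using a b by (intro set_plus_intro) (auto simp: linear_diff[OF lin])
    then show "v \<in> hyperplane \<phi> \<alpha> + hyperplane \<phi> \<beta>" using a by simp
  qed
  then show ?thesis using WSup_hyperplane[OF \<phi>] by (simp add: ws_sum_def)
qed

text \<open>
  The condition \<open>H\<^sup>*(L) \<preceq> U\<close> written without weak suprema: no point of \<open>U\<close> is strictly below a
  value \<open>L x - H x\<close>.
\<close>

definition majorizes :: "('x \<Rightarrow> 'y extended) \<Rightarrow> ('x \<Rightarrow> 'y) \<Rightarrow> 'y extended set \<Rightarrow> bool" where
  "majorizes H L U \<longleftrightarrow> (\<forall>u x. Fin u \<in> U \<longrightarrow> \<not> cone_less K (Fin u) (Fin (L x) - H x))"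

lemma ext_epi_conj_majorizes:
  assumes "(L, U) \<in> ext_epi_conj K H"
  shows "L \<in> cont_lin" "U \<in> Pp K" "majorizes H L U"
proof -
  show "L \<in> cont_lin" "U \<in> Pp K" using assms by (auto simp: ext_epi_conj_def)
  show "majorizes H L U"
    unfolding majorizes_def
  proof (intro allI impI notI)
    fix u x assume "Fin u \<in> U" "cone_less K (Fin u) (Fin (L x) - H x)"
    then have "u \<in> dominated {Fin (L x) - H x | x. True}" by (auto simp: dominated_def)
    then obtain v where "v \<in> conj_map K H L" "cone_less K (Fin u) v"
      using dominated_imp_less_WSup by (auto simp: conj_map_def)
    then show False
      using assms \<open>Fin u \<in> U\<close> by (auto simp: ext_epi_conj_def set_prec_def)
  qed
qed

text \<open>
  A scalar upper bound for \<open>\<phi> (L x - H x)\<close> is enough for membership in the extended epigraph. All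
  elements of the sets \<open>A\<^sub>1\<close>, \<open>A\<^sub>2\<close>, \<open>A\<^sub>3\<close> constructed below arise from it.
\<close>

lemma hyperplane_in_ext_epi_conj:
  assumes \<phi>: "scalarizing \<phi>" and L: "L \<in> cont_lin" and H: "never_Minf H"
    and le: "\<And>x h. H x = Fin h \<Longrightarrow> \<phi> (L x - h) \<le> \<alpha>"
  shows "(L, hyperplane \<phi> \<alpha>) \<in> ext_epi_conj K H"
proof -
  have no: False if v: "v \<in> conj_map K H L" and less: "cone_less K (Fin w) v" and w: "\<phi> w = \<alpha>" for v w
  proof -
    obtain x where x: "cone_less K (Fin w) (Fin (L x) - H x)"
      using v less unfolding conj_map_def WSup_def by blast
    show False
    proof (cases "H x")
      case (Fin h)
      then show ?thesis using x le[OF Fin] w scalarizing_less[OF \<phi>, of "L x - h" w] by simp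
    qed (use x H in \<open>auto simp: never_Minf_def\<close>)
  qed
  obtain w where w: "\<phi> w = \<alpha>" using hyperplane_nonempty[OF \<phi>] by blast
  have "conj_map K H L \<noteq> {Pinf}"
    using no[OF _ _ w, of Pinf] by auto
  moreover have "set_prec K (conj_map K H L) (hyperplane \<phi> \<alpha>)"
    using no unfolding set_prec_def hyperplane_def by blast
  ultimately show ?thesis
    using L hyperplane_in_Pp[OF \<phi>] by (simp add: ext_epi_conj_def dom_conj_def)
qed

lemma epi_conj_iff_majorizes:
  assumes "H x0 \<noteq> Pinf"
  shows "(L, y) \<in> epi_conj K H \<longleftrightarrow> L \<in> cont_lin \<and> majorizes H L {Fin y}"
proof -
  let ?M = "{Fin (L x) - H x | x. True}"
  have "Fin (L x0) - H x0 \<in> ?M" "Fin (L x0) - H x0 \<noteq> Minf"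
    using assms by (auto, cases "H x0") auto
  then have "Fin y \<in> conj_map K H L + Fin ` K \<longleftrightarrow> y \<notin> dominated ?M"
    unfolding conj_map_def by (rule WSup_plus_cone_iff)
  also have "\<dots> \<longleftrightarrow> majorizes H L {Fin y}"
    by (auto simp: dominated_def majorizes_def)
  finally show ?thesis by (simp add: epi_conj_def)
qed

text \<open>
  A set \<open>U\<close> of the partitioning family that is not strictly below the value \<open>L x - h\<close> anywhere
  must have points strictly above each \<open>L x - h - k\<close>: the other two parts of the partition would put
  a point of \<open>U\<close> strictly below \<open>L x - h\<close>.
\<close>

lemma majorizing_Pp_dominates:
  assumes U: "U \<in> Pp K" and maj: "majorizes H L U" and x: "H x = Fin h" and k: "k \<in> interior K"
  shows "\<exists>u. Fin u \<in> U \<and> u - (L x - h - k) \<in> interior K"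
proof -
  obtain V where V: "U = Fin ` V" "UNIV = (V + uminus ` interior K) \<union> V \<union> (V + interior K)"
    using U by (auto simp: Pp_def)
  have not_less: "L x - h - v \<notin> interior K" if "v \<in> V" for v
  proof -
    have "\<not> cone_less K (Fin v) (Fin (L x) - H x)" using maj that V(1) unfolding majorizes_def by blast
    then show ?thesis using x by simp
  qed
  consider "L x - h - k \<in> V + uminus ` interior K" | "L x - h - k \<in> V" | "L x - h - k \<in> V + interior K"
    using V(2) by blast
  then show ?thesis
  proof cases
    case 1
    then obtain v k' where "v \<in> V" "k' \<in> interior K" "L x - h - k = v + - k'"
      by (auto elim!: set_plus_elim)
    then show ?thesis using V(1) by (intro exI[of _ v]) auto
  next
    case 2
    then show ?thesis using not_less[OF 2] k by simp
  next
    case 3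
    then obtain v k' where v: "v \<in> V" "k' \<in> interior K" "L x - h - k = v + k'"
      by (auto elim!: set_plus_elim)
    then have "L x - h - v = k + k'" by (simp add: algebra_simps)
    then show ?thesis using not_less[OF v(1)] interior_add[OF k interior_in_cone[OF v(2)]] by simp
  qed
qed

text \<open>
  Suppose \<open>y\<close> were strictly below \<open>(L1 x - h1) + (L2 x - h2)\<close>. There is room for lowering both
  summands by \<open>t *\<^sub>R k0\<close>; each lowered summand is strictly below a point of \<open>U1\<close> or \<open>U2\<close>, so \<open>y\<close> would be
  strictly below a point of \<open>U1 + U2\<close> and could not be in its weak supremum.
\<close>

lemma ws_sum_majorizes:
  assumes U1: "U1 \<in> Pp K" "majorizes H1 L1 U1" and U2: "U2 \<in> Pp K" "majorizes H2 L2 U2"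
    and H: "never_Minf H1" "never_Minf H2"
  shows "majorizes (H1 +\<^sub>m H2) (\<lambda>x. L1 x + L2 x) (ws_sum K U1 U2)"
  unfolding majorizes_def
proof (intro allI impI notI)
  fix y x assume y: "Fin y \<in> ws_sum K U1 U2"
    and less: "cone_less K (Fin y) (Fin (L1 x + L2 x) - (H1 +\<^sub>m H2) x)"
  obtain h1 h2 where h: "H1 x = Fin h1" "H2 x = Fin h2"
    using less H by (cases "H1 x"; cases "H2 x") (auto simp: add_map_def never_Minf_def)
  let ?k = "(L1 x - h1) + (L2 x - h2) - y"
  have "?k \<in> interior K" using less h by (simp add: add_map_def algebra_simps)
  obtain k0 where k0: "k0 \<in> interior K" using solid by blast
  obtain t where t: "t > 0" "?k - t *\<^sub>R (2 *\<^sub>R k0) \<in> interior K"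
    using interior_shrink[OF \<open>?k \<in> interior K\<close>] by blast
  have tk: "t *\<^sub>R k0 \<in> interior K" using t k0 by (intro interior_scale)
  obtain u1 where u1: "Fin u1 \<in> U1" "u1 - (L1 x - h1 - t *\<^sub>R k0) \<in> interior K"
    using majorizing_Pp_dominates[OF U1 h(1) tk] by blast
  obtain u2 where u2: "Fin u2 \<in> U2" "u2 - (L2 x - h2 - t *\<^sub>R k0) \<in> interior K"
    using majorizing_Pp_dominates[OF U2 h(2) tk] by blast
  have "(u1 - (L1 x - h1 - t *\<^sub>R k0)) + (u2 - (L2 x - h2 - t *\<^sub>R k0)) + (?k - t *\<^sub>R (2 *\<^sub>R k0)) \<in> interior K"
    by (intro interior_add u1 interior_in_cone[OF u2(2)] interior_in_cone[OF t(2)])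
  also have "(u1 - (L1 x - h1 - t *\<^sub>R k0)) + (u2 - (L2 x - h2 - t *\<^sub>R k0)) + (?k - t *\<^sub>R (2 *\<^sub>R k0))
    = (u1 + u2) - y"
    by (simp add: algebra_simps flip: scaleR_2)
  finally have "cone_less K (Fin y) (Fin u1 + Fin u2)" by simp
  moreover have "Fin u1 + Fin u2 \<in> U1 + U2" using u1 u2 by (intro set_plus_intro)
  ultimately show False using y unfolding ws_sum_def WSup_def by blast
qed

end

section \<open>Arithmetic of extended mappings\<close>

lemma never_Minf_add: "never_Minf H1 \<Longrightarrow> never_Minf H2 \<Longrightarrow> never_Minf (H1 +\<^sub>m H2)"
proof -
  assume "never_Minf H1" "never_Minf H2"
  then have "H1 x \<noteq> Minf" "H2 x \<noteq> Minf" for x by (auto simp: never_Minf_def)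
  then have "H1 x + H2 x \<noteq> Minf" for x
    by (cases "H1 x"; cases "H2 x") (metis plus_extended.simps extended.distinct)+
  then show ?thesis by (simp add: never_Minf_def add_map_def)
qed

lemma never_Minf_ind_map: "never_Minf (ind_map D)"
  by (simp add: never_Minf_def ind_map_def)

lemma never_Minf_comp_map: "never_Minf G \<Longrightarrow> never_Minf (comp_map T G)"
  by (simp add: never_Minf_def comp_map_def) (metis extended.exhaust extended.map extended.distinct)

lemma ind_map_eq_Fin: "ind_map D x = Fin h \<longleftrightarrow> x \<in> D \<and> h = 0"
  by (auto simp: ind_map_def)

lemma comp_map_eq_Fin: "comp_map T G x = Fin h \<longleftrightarrow> (\<exists>g. G x = Fin g \<and> h = T g)"
  by (cases "G x") (auto simp: comp_map_def)

lemma add_map_eq_Fin: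
  "(H1 +\<^sub>m H2) x = Fin h \<longleftrightarrow> (\<exists>h1 h2. H1 x = Fin h1 \<and> H2 x = Fin h2 \<and> h = h1 + h2)"
  by (cases "H1 x"; cases "H2 x") (auto simp: add_map_def)

lemma add_map_assoc:
  fixes H1 H2 H3 :: "'x \<Rightarrow> 'y::ab_semigroup_add extended"
  shows "H1 +\<^sub>m H2 +\<^sub>m H3 = H1 +\<^sub>m (H2 +\<^sub>m H3)"
  by (rule ext) (simp add: add_map_def add.assoc)

lemma box_sumI:
  assumes "(L1, U1) \<in> M1" "(L2, U2) \<in> M2" "ws_sum K U1 U2 = U" "U \<in> Pp K"
  shows "(\<lambda>x. L1 x + L2 x, U) \<in> box_sum K M1 M2"
  using assms unfolding box_sum_def by blast

lemma mem_Psi: "(L, y) \<in> Psi M \<longleftrightarrow> (\<exists>U. (L, U) \<in> M \<and> Fin y \<in> U)"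
  by (auto simp: Psi_def)

section \<open>The constrained problem\<close>

context solid_cone
begin

text \<open>
  Weak duality: at a feasible \<open>x\<close> the term \<open>T (G x)\<close> lies in \<open>- K\<close>, so the Lagrangian does not
  exceed the objective there.
\<close>

lemma Lagrangian_majorizes_imp_constrained:
  assumes T: "T \<in> pos_cont_lin S K"
    and F: "never_Minf F" and G: "never_Minf G"
    and maj: "majorizes (F +\<^sub>m ind_map C +\<^sub>m comp_map T G) L U" and y: "Fin y \<in> U"
  shows "majorizes (F +\<^sub>m ind_map (feasible_set S G C)) L {Fin y}"
  unfolding majorizes_def
proof (intro allI impI notI)
  fix u x assume "Fin u \<in> {Fin y}" and less: "cone_less K (Fin u) (Fin (L x) - (F +\<^sub>m ind_map (feasible_set S G C)) x)"
  then have [simp]: "u = y" by simp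
  obtain f where f: "F x = Fin f" "x \<in> feasible_set S G C"
    using less F by (cases "F x") (auto simp: add_map_def ind_map_def never_Minf_def split: if_splits)
  then obtain s where s: "x \<in> C" "s \<in> S" "G x = Fin (- s)" by (auto simp: feasible_set_def)
  have Ts: "T s \<in> K" "T (- s) = - T s"
    using T s(2) by (auto simp: pos_cont_lin_def cont_lin_def linear_neg)
  have "(F +\<^sub>m ind_map C +\<^sub>m comp_map T G) x = Fin (f - T s)"
    using f s Ts by (simp add: add_map_def ind_map_def comp_map_def)
  then have "\<not> cone_less K (Fin y) (Fin (L x) - Fin (f - T s))"
    using maj y unfolding majorizes_def by metis
  moreover have "(L x - f - y) + T s \<in> interior K"
    using less f Ts by (intro interior_add) (auto simp: add_map_def ind_map_def)
  ultimately show False by (simp add: algebra_simps)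
qed

end

lemma cont_lin_linear: "L \<in> cont_lin \<Longrightarrow> linear L"
  by (simp add: cont_lin_def)

locale convex_problem = solid_cone K
  for K :: "'y::locally_convex_space set" +
  fixes S :: "'z::locally_convex_space set"
    and F :: "'x::locally_convex_space \<Rightarrow> 'y extended" and G :: "'x \<Rightarrow> 'z extended" and C :: "'x set"
  assumes S: "convex_cone S"
    and F_Minf: "never_Minf F" and F_convex: "cone_convex K F"
    and G_Minf: "never_Minf G" and G_convex: "cone_convex S G"
    and C: "convex C" and feasible: "feasible_set S G C \<inter> edom F \<noteq> {}"
begin

abbreviation constrained_map :: "'x \<Rightarrow> 'y extended" where
  "constrained_map \<equiv> F +\<^sub>m ind_map (feasible_set S G C)"

lemmas never_Minf_intros = F_Minf G_Minf never_Minf_add never_Minf_ind_map never_Minf_comp_map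

lemma epi_iff: "(L, y) \<in> epi_conj K constrained_map \<longleftrightarrow> L \<in> cont_lin \<and> majorizes constrained_map L {Fin y}"
proof -
  obtain x0 where "x0 \<in> feasible_set S G C" "F x0 \<noteq> Pinf"
    using feasible by (auto simp: edom_def)
  then have "constrained_map x0 \<noteq> Pinf" by (cases "F x0") (auto simp: add_map_def ind_map_def)
  then show ?thesis by (rule epi_conj_iff_majorizes)
qed

lemma A1_subset_epi: "A1 K S F G C \<subseteq> epi_conj K constrained_map"
proof clarify
  fix L y assume "(L, y) \<in> A1 K S F G C"
  then obtain T U where "T \<in> pos_cont_lin S K" "(L, U) \<in> ext_epi_conj K (F +\<^sub>m ind_map C +\<^sub>m comp_map T G)" "Fin y \<in> U"
    unfolding A1_def mem_Psi by blast
  then show "(L, y) \<in> epi_conj K constrained_map"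
    using ext_epi_conj_majorizes Lagrangian_majorizes_imp_constrained F_Minf G_Minf epi_iff by metis
qed

text \<open>
  Merging \<open>U1\<close> and \<open>U2\<close> into their \<open>WS\<close>-sum gives one majorizing set for the whole Lagrangian, to
  which weak duality applies.
\<close>

lemma A2_subset_epi: "A2 K S F G C \<subseteq> epi_conj K constrained_map"
proof clarify
  fix L y assume "(L, y) \<in> A2 K S F G C"
  then obtain T L1 L2 U1 U2 where T: "T \<in> pos_cont_lin S K"
    and L: "L = (\<lambda>x. L1 x + L2 x)" and y: "Fin y \<in> ws_sum K U1 U2"
    and 1: "(L1, U1) \<in> ext_epi_conj K F"
    and 2: "(L2, U2) \<in> ext_epi_conj K (ind_map C +\<^sub>m comp_map T G)"
    unfolding A2_def mem_Psi box_sum_def by blast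
  note e1 = ext_epi_conj_majorizes[OF 1] and e2 = ext_epi_conj_majorizes[OF 2]
  have "majorizes (F +\<^sub>m (ind_map C +\<^sub>m comp_map T G)) L (ws_sum K U1 U2)"
    unfolding L by (intro ws_sum_majorizes e1 e2 never_Minf_intros)
  then have "majorizes constrained_map L {Fin y}"
    unfolding add_map_assoc[symmetric]
    by (rule Lagrangian_majorizes_imp_constrained[OF T F_Minf G_Minf _ y])
  then show "(L, y) \<in> epi_conj K constrained_map"
    unfolding epi_iff L using e1 e2 by (simp add: cont_lin_add)
qed

lemma A3_subset_epi: "A3 K S F G C \<subseteq> epi_conj K constrained_map"
proof clarify
  fix L y assume "(L, y) \<in> A3 K S F G C"
  then obtain T L1 L2 L3 U1 U2 U3 where T: "T \<in> pos_cont_lin S K"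
    and L: "L = (\<lambda>x. L1 x + L2 x + L3 x)" and y: "Fin y \<in> ws_sum K (ws_sum K U1 U2) U3"
    and 1: "(L1, U1) \<in> ext_epi_conj K F" and 2: "(L2, U2) \<in> ext_epi_conj K (ind_map C)"
    and 12: "ws_sum K U1 U2 \<in> Pp K"
    and 3: "(L3, U3) \<in> ext_epi_conj K (comp_map T G)"
    unfolding A3_def mem_Psi box_sum_def by blast
  note e1 = ext_epi_conj_majorizes[OF 1] and e2 = ext_epi_conj_majorizes[OF 2]
    and e3 = ext_epi_conj_majorizes[OF 3]
  have "majorizes (F +\<^sub>m ind_map C +\<^sub>m comp_map T G) L (ws_sum K (ws_sum K U1 U2) U3)"
    unfolding L by (intro ws_sum_majorizes e1 e2 e3 12 never_Minf_intros)
  then have "majorizes constrained_map L {Fin y}"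
    by (rule Lagrangian_majorizes_imp_constrained[OF T F_Minf G_Minf _ y])
  then show "(L, y) \<in> epi_conj K constrained_map"
    unfolding epi_iff L using e1 e2 e3 by (simp add: cont_lin_add)
qed

text \<open>
  The multiplier rule rephrased for points of the epigraph. The functional \<open>\<psi>\<close> is nonnegative on a
  cone with nonempty interior, hence continuous, and \<open>k\<close> turns it into a positive operator.
\<close>

lemma scalar_multipliers_of_epi:
  assumes C1: "cond_C1 S F G C" and Ly: "(L, y) \<in> epi_conj K constrained_map"
  shows "\<exists>\<phi> k \<psi>. scalarizing \<phi> \<and> \<phi> k = 1 \<and> linear \<psi> \<and> (\<forall>s\<in>S. 0 \<le> \<psi> s) \<and> continuous_on UNIV \<psi> \<and>
    (\<lambda>z. \<psi> z *\<^sub>R k) \<in> pos_cont_lin S K \<and>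
    (\<forall>x f g. x \<in> C \<longrightarrow> F x = Fin f \<longrightarrow> G x = Fin g \<longrightarrow> \<phi> (L x - f) - \<psi> g \<le> \<phi> y)"
proof -
  obtain x1 g1 where x1: "x1 \<in> C" "x1 \<in> edom F" "G x1 = Fin g1" "- g1 \<in> interior S"
    using C1 by (auto simp: cond_C1_def mem_uminus_image_iff)
  then obtain f1 where f1: "F x1 = Fin f1" using F_Minf by (cases "F x1") (auto simp: edom_def never_Minf_def)
  interpret S: solid_cone S using S x1 by unfold_locales auto
  have L: "L \<in> cont_lin" "majorizes constrained_map L {Fin y}" using Ly epi_iff by auto
  have no: "L x - f - y \<notin> interior K" if "x \<in> C" "F x = Fin f" "G x = Fin g" "- g \<in> S" for x f g
  proof -
    have "x \<in> feasible_set S G C" using that by (auto simp: feasible_set_def mem_uminus_image_iff)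
    then have "constrained_map x = Fin f" using that by (simp add: add_map_def ind_map_def)
    then have "\<not> cone_less K (Fin y) (Fin (L x) - Fin f)" using L(2) by (metis majorizes_def singletonI)
    then show ?thesis by simp
  qed
  obtain \<phi> \<psi> where \<phi>: "scalarizing \<phi>" and \<psi>: "linear \<psi>" "\<And>s. s \<in> S \<Longrightarrow> 0 \<le> \<psi> s"
    and le: "\<And>x f g. x \<in> C \<Longrightarrow> F x = Fin f \<Longrightarrow> G x = Fin g \<Longrightarrow> \<phi> (L x - f) - \<psi> g \<le> \<phi> y"
  proof (rule scalar_multipliers[OF S F_convex G_convex C cont_lin_linear[OF L(1)] x1(1) f1 x1(3,4)])
    fix x f g assume "x \<in> C" "F x = Fin f" "G x = Fin g" "- g \<in> S"
    then show "L x - f - y \<notin> interior K" by (rule no)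
  qed blast
  obtain k where k: "k \<in> interior K" "\<phi> k = 1" using scalarizing_unit[OF \<phi>] .
  have cont: "continuous_on UNIV \<psi>" by (rule S.nonneg_linear_imp_continuous[OF \<psi>])
  have "(\<lambda>z. \<psi> z *\<^sub>R k) \<in> pos_cont_lin S K"
    using cont_lin_rank_one[OF \<psi>(1) cont, of k] \<psi>(2) interior_in_cone[OF k(1)]
    by (auto simp: pos_cont_lin_def intro!: convex_cone_scaleR[OF cone])
  then show ?thesis using \<phi> \<psi> cont le k(2) by blast
qed

text \<open>
  The scalar inequality bounds \<open>\<phi>\<close> on all values \<open>L x - H x\<close> of the Lagrangian \<open>H\<close>, so the hyperplane
  of \<open>\<phi>\<close> through \<open>y\<close> is the set required.
\<close>

lemma epi_subset_A1:
  assumes C1: "cond_C1 S F G C"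
  shows "epi_conj K constrained_map \<subseteq> A1 K S F G C"
proof clarify
  fix L y assume Ly: "(L, y) \<in> epi_conj K constrained_map"
  obtain \<phi> k \<psi> where \<phi>: "scalarizing \<phi>" "\<phi> k = 1" and T: "(\<lambda>z. \<psi> z *\<^sub>R k) \<in> pos_cont_lin S K"
    and le: "\<And>x f g. x \<in> C \<Longrightarrow> F x = Fin f \<Longrightarrow> G x = Fin g \<Longrightarrow> \<phi> (L x - f) - \<psi> g \<le> \<phi> y"
    using scalar_multipliers_of_epi[OF C1 Ly] by metis
  have lin: "linear \<phi>" using \<phi> by (simp add: scalarizing_def)
  have "(L, hyperplane \<phi> (\<phi> y)) \<in> ext_epi_conj K (F +\<^sub>m ind_map C +\<^sub>m comp_map (\<lambda>z. \<psi> z *\<^sub>R k) G)"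
  proof (rule hyperplane_in_ext_epi_conj[OF \<phi>(1)])
    show "L \<in> cont_lin" using Ly by (simp add: epi_conj_def)
    show "never_Minf (F +\<^sub>m ind_map C +\<^sub>m comp_map (\<lambda>z. \<psi> z *\<^sub>R k) G)" by (intro never_Minf_intros)
    fix x h assume "(F +\<^sub>m ind_map C +\<^sub>m comp_map (\<lambda>z. \<psi> z *\<^sub>R k) G) x = Fin h"
    then obtain f g where "x \<in> C" "F x = Fin f" "G x = Fin g" "h = f + \<psi> g *\<^sub>R k"
      by (auto simp: add_map_eq_Fin ind_map_eq_Fin comp_map_eq_Fin)
    then show "\<phi> (L x - h) \<le> \<phi> y"
      using le[of x f g] \<phi>(2) by (simp add: linear_diff[OF lin] linear_add[OF lin] linear_cmul[OF lin])
  qed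
  then show "(L, y) \<in> A1 K S F G C"
    unfolding A1_def mem_Psi using T by (intro exI[of _ "hyperplane \<phi> (\<phi> y)"]) auto
qed

text \<open>
  The scalarized objective stays above the concave function obtained by moving all other terms of the
  multiplier inequality to the other side. The affine function between the two, turned into an
  operator of rank one, is the share of \<open>L\<close> that goes to \<open>F\<close>.
\<close>

lemma split_objective_of_epi:
  assumes C1: "cond_C1 S F G C" and C2: "cond_C2 F G C" and Ly: "(L, y) \<in> epi_conj K constrained_map"
  shows "\<exists>\<phi> k \<psi> a \<beta>. scalarizing \<phi> \<and> \<phi> k = 1 \<and> linear \<psi> \<and> (\<forall>s\<in>S. 0 \<le> \<psi> s) \<and> continuous_on UNIV \<psi> \<and>
    (\<lambda>z. \<psi> z *\<^sub>R k) \<in> pos_cont_lin S K \<and> linear a \<and>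
    (\<lambda>x. a x *\<^sub>R k) \<in> cont_lin \<and> (\<lambda>x. a x *\<^sub>R k, hyperplane \<phi> \<beta>) \<in> ext_epi_conj K F \<and>
    (\<forall>x g. x \<in> C \<longrightarrow> G x = Fin g \<longrightarrow> \<phi> (L x) - a x - \<psi> g \<le> \<phi> y - \<beta>)"
proof -
  obtain \<phi> k \<psi> where \<phi>: "scalarizing \<phi>" "\<phi> k = 1"
    and \<psi>: "linear \<psi>" "\<And>s. s \<in> S \<Longrightarrow> 0 \<le> \<psi> s" "continuous_on UNIV \<psi>"
    and T: "(\<lambda>z. \<psi> z *\<^sub>R k) \<in> pos_cont_lin S K"
    and le: "\<And>x f g. x \<in> C \<Longrightarrow> F x = Fin f \<Longrightarrow> G x = Fin g \<Longrightarrow> \<phi> (L x - f) - \<psi> g \<le> \<phi> y"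
    using scalar_multipliers_of_epi[OF C1 Ly] by metis
  have lin: "linear \<phi>" using \<phi> by (simp add: scalarizing_def)
  have linL: "linear L" using Ly by (simp add: epi_conj_def cont_lin_def)
  have nonneg: "\<And>k. k \<in> K \<Longrightarrow> 0 \<le> \<phi> k" by (rule scalarizing_nonneg[OF \<phi>(1)])
  obtain x2 where x2: "x2 \<in> C" "x2 \<in> edom G" "ext_continuous_at F x2"
    using C2 by (auto simp: cond_C2_def)
  have "x2 \<in> fin_dom G" using x2 G_Minf by (cases "G x2") (auto simp: fin_dom_def edom_def never_Minf_def)
  obtain U B where U: "open U" "x2 \<in> U" "U \<subseteq> fin_dom F" "\<And>z. z \<in> U \<Longrightarrow> scalarized \<phi> F z \<le> B"
    using scalarized_bounded_near[OF x2(3) nonneg_linear_imp_continuous[OF lin nonneg]] by blast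
  let ?q = "\<lambda>x. scalarized \<psi> G x + (\<phi> y - (\<phi> \<circ> L) x)"
  have convG: "convex_on (fin_dom G) (scalarized \<psi> G)" by (rule convex_on_scalarized[OF G_convex S \<psi>(1,2)])
  then have "convex_on (C \<inter> fin_dom G) (scalarized \<psi> G)"
    using C by (auto simp: convex_on_def convex_Int)
  then have q: "convex_on (C \<inter> fin_dom G) ?q"
    by (rule convex_on_diff_linear) (rule linear_compose[OF linL lin])
  obtain a \<beta> where a: "linear a" "continuous_on UNIV a"
    and aF: "\<And>x. x \<in> fin_dom F \<Longrightarrow> a x - \<beta> \<le> scalarized \<phi> F x"
    and aG: "\<And>x. x \<in> C \<inter> fin_dom G \<Longrightarrow> - ?q x \<le> a x - \<beta>"
  proof (rule convex_sandwich[OF convex_on_scalarized[OF F_convex cone lin nonneg] q _ _ U])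
    show "x2 \<in> C \<inter> fin_dom G" by (intro IntI x2(1)) fact
    fix x assume "x \<in> fin_dom F" "x \<in> C \<inter> fin_dom G"
    then obtain f g where "x \<in> C" "F x = Fin f" "G x = Fin g" by (auto simp: fin_dom_def)
    then show "0 \<le> scalarized \<phi> F x + ?q x"
      using le[of x f g] by (simp add: scalarized_Fin linear_diff[OF lin])
  qed blast+
  have rank: "(\<lambda>x. a x *\<^sub>R k) \<in> cont_lin" by (rule cont_lin_rank_one[OF a])
  have "(\<lambda>x. a x *\<^sub>R k, hyperplane \<phi> \<beta>) \<in> ext_epi_conj K F"
  proof (rule hyperplane_in_ext_epi_conj[OF \<phi>(1) rank F_Minf])
    fix x h assume h: "F x = Fin h"
    then have "x \<in> fin_dom F" by (simp add: fin_dom_def)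
    from aF[OF this] show "\<phi> (a x *\<^sub>R k - h) \<le> \<beta>"
      by (simp add: scalarized_Fin[of F x, OF h] linear_diff[OF lin] linear_cmul[OF lin] \<phi>(2))
  qed
  moreover have "\<phi> (L x) - a x - \<psi> g \<le> \<phi> y - \<beta>" if "x \<in> C" "G x = Fin g" for x g
  proof -
    have "x \<in> C \<inter> fin_dom G" using that by (simp add: fin_dom_def)
    from aG[OF this] show ?thesis by (simp add: scalarized_Fin[of G x, OF that(2)])
  qed
  ultimately show ?thesis using \<phi> \<psi> T a(1) rank by blast
qed

text \<open>
  The part of \<open>L\<close> not given to \<open>F\<close> is given to the constraint term, and the level of \<open>\<phi>\<close> at \<open>y\<close> is
  divided accordingly.
\<close>

lemma epi_subset_A2:
  assumes C1: "cond_C1 S F G C" and C2: "cond_C2 F G C"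
  shows "epi_conj K constrained_map \<subseteq> A2 K S F G C"
proof clarify
  fix L y assume Ly: "(L, y) \<in> epi_conj K constrained_map"
  obtain \<phi> k \<psi> a \<beta> where \<phi>: "scalarizing \<phi>" "\<phi> k = 1"
    and T: "(\<lambda>z. \<psi> z *\<^sub>R k) \<in> pos_cont_lin S K" (is "?T \<in> _")
    and rank: "(\<lambda>x. a x *\<^sub>R k) \<in> cont_lin"
    and 1: "(\<lambda>x. a x *\<^sub>R k, hyperplane \<phi> \<beta>) \<in> ext_epi_conj K F"
    and le: "\<And>x g. x \<in> C \<Longrightarrow> G x = Fin g \<Longrightarrow> \<phi> (L x) - a x - \<psi> g \<le> \<phi> y - \<beta>"
    using split_objective_of_epi[OF C1 C2 Ly] by metis
  have lin: "linear \<phi>" using \<phi> by (simp add: scalarizing_def)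
  have L: "L \<in> cont_lin" using Ly by (simp add: epi_conj_def)
  have 2: "(\<lambda>x. L x - a x *\<^sub>R k, hyperplane \<phi> (\<phi> y - \<beta>)) \<in> ext_epi_conj K (ind_map C +\<^sub>m comp_map ?T G)"
  proof (rule hyperplane_in_ext_epi_conj[OF \<phi>(1) cont_lin_diff[OF L rank]])
    show "never_Minf (ind_map C +\<^sub>m comp_map ?T G)" by (intro never_Minf_intros)
    fix x h assume "(ind_map C +\<^sub>m comp_map ?T G) x = Fin h"
    then obtain g where "x \<in> C" "G x = Fin g" "h = \<psi> g *\<^sub>R k"
      by (auto simp: add_map_eq_Fin ind_map_eq_Fin comp_map_eq_Fin)
    then show "\<phi> (L x - a x *\<^sub>R k - h) \<le> \<phi> y - \<beta>"
      using le[of x g] by (simp add: linear_diff[OF lin] linear_cmul[OF lin] \<phi>(2))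
  qed
  have sum: "ws_sum K (hyperplane \<phi> \<beta>) (hyperplane \<phi> (\<phi> y - \<beta>)) = hyperplane \<phi> (\<phi> y)"
    by (simp add: ws_sum_hyperplane[OF \<phi>(1)])
  have "(\<lambda>x. a x *\<^sub>R k + (L x - a x *\<^sub>R k), hyperplane \<phi> (\<phi> y))
    \<in> box_sum K (ext_epi_conj K F) (\<Union>T\<in>pos_cont_lin S K. ext_epi_conj K (ind_map C +\<^sub>m comp_map T G))"
    by (rule box_sumI[OF 1 _ sum hyperplane_in_Pp[OF \<phi>(1)]]) (rule UN_I[OF T], rule 2)
  then show "(L, y) \<in> A2 K S F G C"
    unfolding A2_def mem_Psi by (intro exI[of _ "hyperplane \<phi> (\<phi> y)"]) simp
qed

text \<open>
  Continuity of \<open>G\<close> at a point of \<open>C\<close> allows a second sandwich, between the scalarized \<open>G\<close> and the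
  affine remainder on \<open>C\<close>, so that \<open>L\<close> and the level \<open>\<phi> y\<close> are both divided into three parts.
\<close>

lemma epi_subset_A3:
  assumes C1: "cond_C1 S F G C" and C2: "cond_C2 F G C" and C3: "cond_C3 G C"
  shows "epi_conj K constrained_map \<subseteq> A3 K S F G C"
proof clarify
  fix L y assume Ly: "(L, y) \<in> epi_conj K constrained_map"
  obtain \<phi> k \<psi> a \<beta> where \<phi>: "scalarizing \<phi>" "\<phi> k = 1"
    and \<psi>: "linear \<psi>" "\<And>s. s \<in> S \<Longrightarrow> 0 \<le> \<psi> s" "continuous_on UNIV \<psi>"
    and T: "(\<lambda>z. \<psi> z *\<^sub>R k) \<in> pos_cont_lin S K" (is "?T \<in> _")
    and a: "linear a" and rank: "(\<lambda>x. a x *\<^sub>R k) \<in> cont_lin"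
    and 1: "(\<lambda>x. a x *\<^sub>R k, hyperplane \<phi> \<beta>) \<in> ext_epi_conj K F"
    and le: "\<And>x g. x \<in> C \<Longrightarrow> G x = Fin g \<Longrightarrow> \<phi> (L x) - a x - \<psi> g \<le> \<phi> y - \<beta>"
    using split_objective_of_epi[OF C1 C2 Ly] by metis
  have lin: "linear \<phi>" using \<phi> by (simp add: scalarizing_def)
  have L: "L \<in> cont_lin" using Ly by (simp add: epi_conj_def)
  obtain x3 where x3: "x3 \<in> C" "ext_continuous_at G x3"
    using C3 by (auto simp: cond_C3_def)
  obtain U B where U: "open U" "x3 \<in> U" "U \<subseteq> fin_dom G" "\<And>z. z \<in> U \<Longrightarrow> scalarized \<psi> G z \<le> B"
    using scalarized_bounded_near[OF x3(2) \<psi>(3)] by blast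
  have "linear (\<lambda>x. (\<phi> \<circ> L) x - a x)"
    by (intro linear_compose_sub linear_compose cont_lin_linear[OF L] lin a)
  then have q: "convex_on C (\<lambda>x. 0 + ((\<phi> y - \<beta>) - ((\<phi> \<circ> L) x - a x)))" (is "convex_on C ?q")
    by (intro convex_on_diff_linear) (auto simp: convex_on_def C)
  obtain b \<gamma> where b: "linear b" "continuous_on UNIV b"
    and bG: "\<And>x. x \<in> fin_dom G \<Longrightarrow> b x - \<gamma> \<le> scalarized \<psi> G x"
    and bC: "\<And>x. x \<in> C \<Longrightarrow> - ?q x \<le> b x - \<gamma>"
  proof (rule convex_sandwich[OF convex_on_scalarized[OF G_convex S \<psi>(1,2)] q _ x3(1) U])
    fix x assume "x \<in> fin_dom G" "x \<in> C"
    then obtain g where "x \<in> C" "G x = Fin g" by (auto simp: fin_dom_def)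
    then show "0 \<le> scalarized \<psi> G x + ?q x"
      using le[of x g] by (simp add: scalarized_Fin)
  qed blast+
  have rank': "(\<lambda>x. b x *\<^sub>R k) \<in> cont_lin" by (rule cont_lin_rank_one[OF b])
  have 3: "(\<lambda>x. b x *\<^sub>R k, hyperplane \<phi> \<gamma>) \<in> ext_epi_conj K (comp_map ?T G)"
  proof (rule hyperplane_in_ext_epi_conj[OF \<phi>(1) rank'])
    show "never_Minf (comp_map ?T G)" by (intro never_Minf_intros)
    fix x h assume "comp_map ?T G x = Fin h"
    then obtain g where g: "G x = Fin g" "h = \<psi> g *\<^sub>R k" by (auto simp: comp_map_eq_Fin)
    then have "x \<in> fin_dom G" by (simp add: fin_dom_def)
    from bG[OF this] show "\<phi> (b x *\<^sub>R k - h) \<le> \<gamma>"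
      using g by (simp add: scalarized_Fin[of G x g] linear_diff[OF lin] linear_cmul[OF lin] \<phi>(2))
  qed
  have 2: "(\<lambda>x. L x - a x *\<^sub>R k - b x *\<^sub>R k, hyperplane \<phi> (\<phi> y - \<beta> - \<gamma>)) \<in> ext_epi_conj K (ind_map C)"
  proof (rule hyperplane_in_ext_epi_conj[OF \<phi>(1) cont_lin_diff[OF cont_lin_diff[OF L rank] rank'] never_Minf_ind_map])
    fix x and h :: 'y assume "ind_map C x = Fin h"
    then have "x \<in> C" "h = 0" by (auto simp: ind_map_eq_Fin)
    then show "\<phi> (L x - a x *\<^sub>R k - b x *\<^sub>R k - h) \<le> \<phi> y - \<beta> - \<gamma>"
      using bC[of x] by (simp add: linear_diff[OF lin] linear_cmul[OF lin] \<phi>(2))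
  qed
  have sum: "ws_sum K (hyperplane \<phi> \<beta>) (hyperplane \<phi> (\<phi> y - \<beta> - \<gamma>)) = hyperplane \<phi> (\<phi> y - \<gamma>)"
    "ws_sum K (hyperplane \<phi> (\<phi> y - \<gamma>)) (hyperplane \<phi> \<gamma>) = hyperplane \<phi> (\<phi> y)"
    by (simp_all add: ws_sum_hyperplane[OF \<phi>(1)])
  have 12: "(\<lambda>x. a x *\<^sub>R k + (L x - a x *\<^sub>R k - b x *\<^sub>R k), hyperplane \<phi> (\<phi> y - \<gamma>))
    \<in> box_sum K (ext_epi_conj K F) (ext_epi_conj K (ind_map C))"
    by (rule box_sumI[OF 1 2 sum(1) hyperplane_in_Pp[OF \<phi>(1)]])
  have "(\<lambda>x. a x *\<^sub>R k + (L x - a x *\<^sub>R k - b x *\<^sub>R k) + b x *\<^sub>R k, hyperplane \<phi> (\<phi> y))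
    \<in> box_sum K (box_sum K (ext_epi_conj K F) (ext_epi_conj K (ind_map C)))
        (\<Union>T\<in>pos_cont_lin S K. ext_epi_conj K (comp_map T G))"
    by (rule box_sumI[OF 12 _ sum(2) hyperplane_in_Pp[OF \<phi>(1)]]) (rule UN_I[OF T], rule 3)
  then show "(L, y) \<in> A3 K S F G C"
    unfolding A3_def mem_Psi by (intro exI[of _ "hyperplane \<phi> (\<phi> y)"]) simp
qed

end

theorem theorem4p1:
  fixes K :: "'y::locally_convex_space set"
    and S :: "'z::locally_convex_space set"
    and F :: "'x::locally_convex_space \<Rightarrow> 'y extended"
    and G :: "'x \<Rightarrow> 'z extended"
    and C :: "'x set"
  assumes "convex_cone K" "closed K" "K \<noteq> UNIV" "interior K \<noteq> {}"
    and "convex_cone S" "closed S"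
    and "never_Minf F" "proper_ext F" "cone_convex K F"
    and "never_Minf G" "proper_ext G" "cone_convex S G"
    and "C \<noteq> {}" "convex C"
    and "feasible_set S G C \<inter> edom F \<noteq> {}"
  shows "(cond_C1 S F G C \<longrightarrow>
            epi_conj K (F +\<^sub>m ind_map (feasible_set S G C)) = A1 K S F G C) \<and>
         (cond_C1 S F G C \<and> cond_C2 F G C \<longrightarrow>
            epi_conj K (F +\<^sub>m ind_map (feasible_set S G C)) = A2 K S F G C) \<and>
         (cond_C1 S F G C \<and> cond_C2 F G C \<and> cond_C3 G C \<longrightarrow>
            epi_conj K (F +\<^sub>m ind_map (feasible_set S G C)) = A3 K S F G C)"
proof -
  interpret convex_problem K S F G C using assms by unfold_locales
  show ?thesis
    using A1_subset_epi epi_subset_A1 A2_subset_epi epi_subset_A2 A3_subset_epi epi_subset_A3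
    by (meson subset_antisym)
qed

end
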